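(* Let $V_0$ be a real function of $r$ and $$H=-\frac{\hbar^2}{2}\nabla^2+V_0(r)+\frac{\hbar}{2r^2}(\vec\sigma_1+\vec\sigma_2,\vec L)+\frac{\hbar^2}{4r^2}(\vec\sigma_1,\vec\sigma_2).$$ Let $K,Y_P^1,\dots,Y_P^7$ be the integrals of motion of $H$ defined in the context, and let $$X=(\vec\sigma_2,\vec L),\qquad Y=(\vec\sigma_1,\vec L),\qquad Z=(\vec\sigma_1\times\vec\sigma_2,\vec L).$$ Then the operators in $\mathcal G=\{K,Y_P^5,Y_P^6,Y_P^7,X,Y,Z\}$ generate a finite polynomial symmetry algebra. In addition to the commutation relations among $K,Y_P^5,Y_P^6,Y_P^7$, $$[K,Y_P^6]=2iY_P^5,\quad [K,Y_P^5]=4iY_P^7,\quad [K,Y_P^7]=-4iY_P^5,\quad [Y_P^6,Y_P^7]=0,$$ $$[Y_P^6,Y_P^5]=2i\left(K-1+\tfrac12(Y_P^5)^2\right),\quad [Y_P^7,Y_P^5]=-4i\left(K-1+\tfrac12(Y_P^5)^2\right),$$ the non-trivial commutation relations involving $X,Y$ and $Z$ are $$[K,Y]=2iZ,\quad [K,X]=-2iZ,\quad [K,Z]=4i(X-Y),\quad [Y,X]=i\hbar Z,$$ $$[Y,Y_P^6]=2iY_P^3,\quad [X,Y_P^6]=-i\hbar Y_P^5,$$ $$[Y,Y_P^7]=i\hbar Y_P^5-2iY_P^3,\quad [X,Y_P^7]=-2iY_P^2+i\hbar Y_P^5,$$ $$[Y,Y_P^5]=2iY_P^1-2i\hbar(Y_P^6+Y_P^7),\quad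 [X,Y_P^5]=-2i(Y_P^1+Y_P^4)+2i\hbar Y_P^6.$$ Moreover, the commutators involving $Z$ are polynomial in the generators: $$[Y,Z]=2iK\vec L^2-i(YX+XY)-2i\hbar X,\qquad [X,Z]=-2iK\vec L^2+i(YX+XY)+2i\hbar Y,$$ where $$\vec L^2=\vec J^2-\hbar(X+Y)-\frac{\hbar^2}{4}(6+2K).$$ The operators $Y_P^1,\dots,Y_P^4$ appearing on the right-hand sides are polynomial expressions in the generators of $\mathcal G$: $$Y_P^1=-Y_P^6X+\tfrac{i\hbar}{2}Y_P^5,\quad Y_P^2=-i(Y_P^6+Y_P^7)(X+\hbar),\quad Y_P^3=iY_P^6(Y+\hbar),\quad Y_P^4=Y_P^6X-(Y_P^6+Y_P^7)Y-i\hbar Y_P^5.$$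
   Context: $\vec x\in\mathbb R^3$, $r=|\vec x|$, $p_k=-i\hbar\,\partial/\partial x_k$, $\vec L=\vec x\times\vec p$, $(\cdot,\cdot)$ is the Euclidean inner product; $\vec\sigma$ is the vector of Pauli matrices, $\vec\sigma_1=\vec\sigma\otimes I_2$, $\vec\sigma_2=I_2\otimes\vec\sigma$, $\vec J=\vec L+\frac\hbar2(\vec\sigma_1+\vec\sigma_2)$. Operators act on four-component spinors; products are in the order written. An integral of motion is an operator commuting with $H$. The Hamiltonian $H$, the rotational generators $J_i$ (hence $\vec J^2$) and $K$ are always included as trivial integrals of motion, so $\vec J^2$ may appear in the polynomial relations. Definitions: $K=(\vec\sigma_1,\vec\sigma_2)$, $Y_P^1=-\frac1r(\vec\sigma_1,\vec x)(\vec\sigma_2,\vec L)+\frac{i\hbar}{2r}(\vec x,\vec\sigma_1\times\vec\sigma_2)$, $Y_P^2=\frac1r(\vec\sigma_2,\vec x)(\vec x,\vec p)-r(\vec\sigma_2,\vec p)-\frac{i\hbar}r(\vec\sigma_2,\vec x)$, $Y_P^3=r(\vec\sigma_1,\vec p)-\frac1r(\vec\sigma_1,\vec x)(\vec x,\vec p)+\frac{i\hbar}r(\vec\sigma_1,\vec x)$, $Y_P^4=-\frac1r\left[(\vec\sigma_2,\vec x)(\vec\sigma_1,\vec L)-(\vec\sigma_1,\vec x)(\vec\sigma_2,\vec L)+i\hbar(\vec x,\vec\sigma_1\times\vec\sigma_2)\right]$, $Y_P^5=\frac1r(\vec x,\vec\sigma_1\times\vec\sigma_2)$, $Y_P^6=\frac1r(\vec\sigma_1,\vec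 x)$, $Y_P^7=\frac1r(\vec\sigma_2-\vec\sigma_1,\vec x)$. *)

theory Defs
  imports "HOL-Analysis.Analysis" "HOL-Library.Function_Algebras"
begin

text \<open>
  Four-component spinors are the elements of the tensor square of \<open>complex^2\<close>, with components
  indexed by pairs.  Operators transform spinor fields on \<open>real^3\<close>; they are compared only on
  smooth fields and only off the origin (see \<open>op_eq\<close>), so that values at the origin,
  where \<open>1/r\<close> is singular, play no role.  Sums, differences and \<open>0\<close> of operators are the pointwise
  ones of \<^theory>\<open>HOL-Library.Function_Algebras\<close>.  The pointwise \<open>*\<close> and \<open>1\<close> of that theory are
  not the operator product and the identity operator, for which \<open>\<cdot>\<close> and \<^const>\<open>id\<close> are used.
\<close>

type_synonym spinor = "complex ^ (2 \<times> 2)"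
type_synonym spinor_op = "(real^3 \<Rightarrow> spinor) \<Rightarrow> (real^3 \<Rightarrow> spinor)"

abbreviation op_mult :: "spinor_op \<Rightarrow> spinor_op \<Rightarrow> spinor_op" (infixl "\<cdot>" 70)
  where "A \<cdot> B \<equiv> A \<circ> B"

definition op_scale :: "complex \<Rightarrow> spinor_op \<Rightarrow> spinor_op" (infixr "*\<^sub>o" 75)
  where "c *\<^sub>o A = (\<lambda>\<psi> x. c *s A \<psi> x)"

definition commutator :: "spinor_op \<Rightarrow> spinor_op \<Rightarrow> spinor_op"
  where "commutator A B = A \<cdot> B - B \<cdot> A"

definition partial_deriv :: "3 \<Rightarrow> spinor_op"
  where "partial_deriv k \<psi> x = frechet_derivative \<psi> (at x) (axis k 1)"

text \<open>For open \<open>S\<close>: all partial derivatives of order up to \<open>n\<close> exist and are continuous on \<open>S\<close>.\<close>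

primrec C_n_on :: "nat \<Rightarrow> (real^3) set \<Rightarrow> (real^3 \<Rightarrow> spinor) \<Rightarrow> bool"
  where
    "C_n_on 0 S \<psi> \<longleftrightarrow> continuous_on S \<psi>"
  | "C_n_on (Suc n) S \<psi> \<longleftrightarrow> \<psi> differentiable_on S \<and> (\<forall>k. C_n_on n S (partial_deriv k \<psi>))"

definition smooth_off_origin :: "(real^3 \<Rightarrow> spinor) \<Rightarrow> bool"
  where "smooth_off_origin \<psi> \<longleftrightarrow> (\<forall>n. C_n_on n (- {0}) \<psi>)"

definition op_eq :: "spinor_op \<Rightarrow> spinor_op \<Rightarrow> bool" (infix "\<doteq>" 50)
  where "A \<doteq> B \<longleftrightarrow> (\<forall>\<psi>. smooth_off_origin \<psi> \<longrightarrow> (\<forall>x. x \<noteq> 0 \<longrightarrow> A \<psi> x = B \<psi> x))"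

definition radial :: "(real \<Rightarrow> real) \<Rightarrow> spinor_op"
  where "radial f \<psi> x = complex_of_real (f (norm x)) *s \<psi> x"

definition pos :: "3 \<Rightarrow> spinor_op"
  where "pos k \<psi> x = complex_of_real (x $ k) *s \<psi> x"

definition mom :: "real \<Rightarrow> 3 \<Rightarrow> spinor_op"
  where "mom hbar k = (- \<i> * hbar) *\<^sub>o partial_deriv k"

definition laplacian :: spinor_op
  where "laplacian = (\<Sum>k\<in>UNIV. partial_deriv k \<cdot> partial_deriv k)"

definition op_inner :: "(3 \<Rightarrow> spinor_op) \<Rightarrow> (3 \<Rightarrow> spinor_op) \<Rightarrow> spinor_op"
  where "op_inner A B = (\<Sum>k\<in>UNIV. A k \<cdot> B k)"

text \<open>The index type \<open>3\<close> is the integers modulo 3, so \<open>k + 1\<close> and \<open>k + 2\<close> are cyclic successors.\<close>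

definition op_cross :: "(3 \<Rightarrow> spinor_op) \<Rightarrow> (3 \<Rightarrow> spinor_op) \<Rightarrow> 3 \<Rightarrow> spinor_op"
  where "op_cross A B k = A (k + 1) \<cdot> B (k + 2) - A (k + 2) \<cdot> B (k + 1)"

definition pauli :: "3 \<Rightarrow> complex^2^2"
  where "pauli k =
    (if k = 1 then vector [vector [0, 1], vector [1, 0]]
     else if k = 2 then vector [vector [0, - \<i>], vector [\<i>, 0]]
     else vector [vector [1, 0], vector [0, - 1]])"

definition kronecker :: "complex^2^2 \<Rightarrow> complex^2^2 \<Rightarrow> complex^(2 \<times> 2)^(2 \<times> 2)"
  where "kronecker A B = (\<chi> i j. A $ fst i $ fst j * B $ snd i $ snd j)"

definition sigma1 :: "3 \<Rightarrow> spinor_op"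
  where "sigma1 k \<psi> x = kronecker (pauli k) (mat 1) *v \<psi> x"

definition sigma2 :: "3 \<Rightarrow> spinor_op"
  where "sigma2 k \<psi> x = kronecker (mat 1) (pauli k) *v \<psi> x"

definition ang_mom :: "real \<Rightarrow> 3 \<Rightarrow> spinor_op"
  where "ang_mom hbar = op_cross pos (mom hbar)"

definition tot_ang_mom :: "real \<Rightarrow> 3 \<Rightarrow> spinor_op"
  where "tot_ang_mom hbar k = ang_mom hbar k + (hbar / 2) *\<^sub>o (sigma1 k + sigma2 k)"

definition L_sq :: "real \<Rightarrow> spinor_op"
  where "L_sq hbar = op_inner (ang_mom hbar) (ang_mom hbar)"

definition J_sq :: "real \<Rightarrow> spinor_op"
  where "J_sq hbar = op_inner (tot_ang_mom hbar) (tot_ang_mom hbar)"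

definition Ham :: "real \<Rightarrow> (real \<Rightarrow> real) \<Rightarrow> spinor_op"
  where "Ham hbar V0 =
    (- (hbar\<^sup>2 / 2)) *\<^sub>o laplacian + radial V0
    + radial (\<lambda>r. hbar / (2 * r\<^sup>2)) \<cdot> op_inner (\<lambda>k. sigma1 k + sigma2 k) (ang_mom hbar)
    + radial (\<lambda>r. hbar\<^sup>2 / (4 * r\<^sup>2)) \<cdot> op_inner sigma1 sigma2"

abbreviation sigma_cross :: "3 \<Rightarrow> spinor_op"
  where "sigma_cross \<equiv> op_cross sigma1 sigma2"

abbreviation inv_r :: spinor_op
  where "inv_r \<equiv> radial (\<lambda>r. 1 / r)"

definition K_op :: spinor_op
  where "K_op = op_inner sigma1 sigma2"

definition YP1 :: "real \<Rightarrow> spinor_op"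
  where "YP1 hbar =
    - (inv_r \<cdot> op_inner sigma1 pos \<cdot> op_inner sigma2 (ang_mom hbar))
    + (\<i> * hbar / 2) *\<^sub>o (inv_r \<cdot> op_inner pos sigma_cross)"

definition YP2 :: "real \<Rightarrow> spinor_op"
  where "YP2 hbar =
    inv_r \<cdot> op_inner sigma2 pos \<cdot> op_inner pos (mom hbar)
    - radial (\<lambda>r. r) \<cdot> op_inner sigma2 (mom hbar)
    - (\<i> * hbar) *\<^sub>o (inv_r \<cdot> op_inner sigma2 pos)"

definition YP3 :: "real \<Rightarrow> spinor_op"
  where "YP3 hbar =
    radial (\<lambda>r. r) \<cdot> op_inner sigma1 (mom hbar)
    - inv_r \<cdot> op_inner sigma1 pos \<cdot> op_inner pos (mom hbar)
    + (\<i> * hbar) *\<^sub>o (inv_r \<cdot> op_inner sigma1 pos)"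

definition YP4 :: "real \<Rightarrow> spinor_op"
  where "YP4 hbar =
    - (inv_r \<cdot> (op_inner sigma2 pos \<cdot> op_inner sigma1 (ang_mom hbar)
                - op_inner sigma1 pos \<cdot> op_inner sigma2 (ang_mom hbar)
                + (\<i> * hbar) *\<^sub>o op_inner pos sigma_cross))"

definition YP5 :: spinor_op
  where "YP5 = inv_r \<cdot> op_inner pos sigma_cross"

definition YP6 :: spinor_op
  where "YP6 = inv_r \<cdot> op_inner sigma1 pos"

definition YP7 :: spinor_op
  where "YP7 = inv_r \<cdot> op_inner (\<lambda>k. sigma2 k - sigma1 k) pos"

definition X_op :: "real \<Rightarrow> spinor_op"
  where "X_op hbar = op_inner sigma2 (ang_mom hbar)"

definition Y_op :: "real \<Rightarrow> spinor_op"
  where "Y_op hbar = op_inner sigma1 (ang_mom hbar)"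

definition Z_op :: "real \<Rightarrow> spinor_op"
  where "Z_op hbar = op_inner sigma_cross (ang_mom hbar)"

definition integral_of_motion :: "spinor_op \<Rightarrow> spinor_op \<Rightarrow> bool"
  where "integral_of_motion H A \<longleftrightarrow> commutator H A \<doteq> 0"

text \<open>
  Every commutator \<open>A B - B A\<close> is trivially a noncommutative polynomial in \<open>A\<close> and \<open>B\<close>.  What makes
  an algebra of operators polynomial is that commutators are polynomials in a fixed ordering of the
  generators, i.e. linear combinations of the ordered monomials
  \<open>A\<^sub>1^e\<^sub>1 \<cdots> A\<^sub>m^e\<^sub>m\<close>.
\<close>

definition ordered_monomial :: "spinor_op list \<Rightarrow> nat list \<Rightarrow> spinor_op"
  where "ordered_monomial As es = foldr (\<lambda>(A, e) B. (A ^^ e) \<cdot> B) (zip As es) id"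

definition ordered_polynomials :: "spinor_op list \<Rightarrow> spinor_op set"
  where "ordered_polynomials As =
    {\<Sum>es\<in>M. c es *\<^sub>o ordered_monomial As es | M c. finite M \<and> M \<subseteq> {es. length es = length As}}"

text \<open>
  The Hamiltonian itself needs no place in the list of generators: it commutes with all of them.
\<close>

definition finite_polynomial_symmetry_algebra :: "spinor_op \<Rightarrow> spinor_op list \<Rightarrow> bool"
  where "finite_polynomial_symmetry_algebra H As \<longleftrightarrow>
    (\<forall>A\<in>set As. integral_of_motion H A) \<and>
    (\<forall>A\<in>set As. \<forall>B\<in>set As. \<exists>P\<in>ordered_polynomials As. commutator A B \<doteq> P)"

end

theory Submission
  imports Defs
begin

text \<open>
  Operators that preserve smooth spinor fields, taken modulo equality off the origin, form a ring in
  which scalars are central.  In it every operator of the proposition is a polynomial in the Pauli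
  matrices, the components of \<open>n = x/r\<close> and of \<open>L\<close>; once the \<open>L\<close>'s are moved to the right, an
  identity becomes an identity between the four components of a spinor, up to the relations
  \<open>(n, n) = 1\<close> and \<open>(n, L) = 0\<close>.

  For conservation, the generators commute with \<open>r\<close>, with the Euler operator \<open>E = (x, \<nabla>)\<close> and with
  \<open>J\<^sup>2\<close>, while \<open>H\<close> is the sum of \<open>V\<^sub>0(r)\<close>, of \<open>- (h\<^sup>2 / 2 r\<^sup>2) (E\<^sup>2 + E)\<close> and of
  \<open>(1 / 2 r\<^sup>2) (J\<^sup>2 - 3 h\<^sup>2 / 2)\<close>.  As \<open>V\<^sub>0\<close> is only differentiable, \<open>H\<close> itself does not preserve
  smoothness; but the integrals of motion are of first order, so at a given point \<open>V\<^sub>0\<close> may be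
  replaced by its linearization.
\<close>

section \<open>Smooth spinor fields\<close>

text \<open>What shapes the algebraic half is that closure is asked with ordered polynomials, which
  are stable under linear combinations but not evidently under products. Every commutator has to be
  brought to monomials that respect the order \<open>J_i\<close>, \<open>K\<close>,
  \<open>YP5\<close>, \<open>YP6\<close>, \<open>YP7\<close>, \<open>X\<close>, \<open>Y\<close>,
  \<open>Z\<close>; this includes the commutators of \<open>Z\<close> with \<open>YP5\<close>,
  \<open>YP6\<close>, \<open>YP7\<close>, which the displayed relations do not list. Moving
  \<open>L\<close> to the right of the matrices serves this order too. The term \<open>K L^2\<close>
  becomes a polynomial only through \<open>J^2\<close>, which is why the three \<open>J_i\<close>
  belong to the list of generators.

  With \<open>A = (sigma_1, n)\<close>, \<open>B = (sigma_2, n)\<close> and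
  \<open>N = (n, sigma_1 x sigma_2)\<close>, two identities carry most of the content:
  \<open>A\<close> anticommutes with \<open>Y + h\<close>, because \<open>(n, L) = 0\<close>, and
  \<open>A B = 1 - N^2 / 2\<close>, because \<open>(n, n) = 1\<close>. The computations use
  \<open>B\<close> instead of \<open>YP7 = B - A\<close> because exchanging the two spins swaps
  \<open>A\<close> with \<open>B\<close> and \<open>X\<close> with \<open>Y\<close> and changes the
  sign of \<open>N\<close> and \<open>Z\<close>, so that relations come in pairs.\<close>

lemma numeral_3_simps: "(1::3) + 1 = 2" "(2::3) + 1 = 3" "(3::3) + 1 = 1"
  "(1::3) + 2 = 3" "(2::3) + 2 = 1" "(3::3) + 2 = 2"
  "(4::3) = 1" "(5::3) = 2" "(6::3) = 3" "(7::3) = 1"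
  by simp_all

lemma partial_deriv_eq:
  assumes "(\<psi> has_derivative D) (at x)"
  shows "partial_deriv k \<psi> x = D (axis k 1)"
  using frechet_derivative_at[OF assms] by (simp add: partial_deriv_def)

lemma differentiable_cong_off_origin:
  assumes "\<And>y. y \<noteq> 0 \<Longrightarrow> \<psi> y = \<phi> y" and "x \<noteq> (0::real^3)"
  shows "\<psi> differentiable (at x) \<longleftrightarrow> \<phi> differentiable (at x)"
proof -
  have "\<phi> differentiable (at x)" if "\<psi> differentiable (at x)" "\<And>y. y \<noteq> 0 \<Longrightarrow> \<psi> y = \<phi> y"
    for \<psi> \<phi> :: "real^3 \<Rightarrow> _"
    using that has_derivative_transform_within_open[of \<psi> _ x UNIV "-{0}" \<phi>] assms(2)
    unfolding differentiable_def by blast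
  from this[of \<psi> \<phi>] this[of \<phi> \<psi>] assms(1) show ?thesis
    by fastforce
qed

lemma partial_deriv_cong:
  assumes "\<And>y. y \<noteq> 0 \<Longrightarrow> \<psi> y = \<phi> y" and "x \<noteq> 0" and "\<psi> differentiable (at x)"
  shows "partial_deriv k \<psi> x = partial_deriv k \<phi> x"
proof -
  have "frechet_derivative \<psi> (at x) = frechet_derivative \<phi> (at x)"
    by (rule frechet_derivative_transform_within_open[of _ _ "-{0}"]) (use assms in auto)
  then show ?thesis by (simp only: partial_deriv_def)
qed

lemma differentiable_on_off_origin:
  fixes \<psi> :: "real^3 \<Rightarrow> 'a::real_normed_vector"
  shows "\<psi> differentiable_on (-{0}) \<longleftrightarrow> (\<forall>x. x \<noteq> 0 \<longrightarrow> \<psi> differentiable (at x))"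
proof -
  have "open (-{0::real^3})" by auto
  from differentiable_on_eq_differentiable_at[OF this] show ?thesis
    by auto
qed

lemma C_n_on_cong:
  assumes "\<And>y. y \<noteq> 0 \<Longrightarrow> \<psi> y = \<phi> y"
  shows "C_n_on n (-{0}) \<psi> \<longleftrightarrow> C_n_on n (-{0}) \<phi>"
  using assms
proof (induction n arbitrary: \<psi> \<phi>)
  case 0
  then show ?case
    using continuous_on_cong[of "-{0}" "-{0}" \<psi> \<phi>] by simp
next
  case (Suc n)
  have d: "\<psi> differentiable_on (-{0}) \<longleftrightarrow> \<phi> differentiable_on (-{0})"
    using differentiable_cong_off_origin[of \<psi> \<phi>] Suc.prems
    by (simp add: differentiable_on_off_origin)
  \<comment> \<open>\<open>frechet_derivative\<close> is unspecified where no derivative exists, so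
    the partial derivatives are compared only for differentiable \<psi>; otherwise both sides of the
    claim are false by \<open>d\<close>.\<close>
  have "C_n_on n (-{0}) (partial_deriv k \<psi>) \<longleftrightarrow> C_n_on n (-{0}) (partial_deriv k \<phi>)"
    if "\<psi> differentiable_on (-{0})" for k
    using that Suc.prems
    by (intro Suc.IH partial_deriv_cong) (auto simp: differentiable_on_off_origin)
  then show ?case using d by auto
qed

lemma C_n_on_mono: "C_n_on (Suc n) S \<psi> \<Longrightarrow> C_n_on n S \<psi>"
  by (induction n arbitrary: \<psi>) (auto intro: differentiable_imp_continuous_on)

lemma smooth_cong:
  assumes "\<And>y. y \<noteq> 0 \<Longrightarrow> \<psi> y = \<phi> y"
  shows "smooth_off_origin \<psi> \<longleftrightarrow> smooth_off_origin \<phi>"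
  unfolding smooth_off_origin_def using C_n_on_cong[OF assms] by auto

lemma smooth_imp_differentiable:
  assumes "smooth_off_origin \<psi>" and "x \<noteq> 0"
  shows "\<psi> differentiable (at x)"
proof -
  have "C_n_on 1 (-{0}) \<psi>"
    using assms(1) by (simp add: smooth_off_origin_def)
  then show ?thesis using assms(2) by (simp add: differentiable_on_off_origin)
qed

lemma smooth_partial_deriv:
  assumes "smooth_off_origin \<psi>" shows "smooth_off_origin (partial_deriv k \<psi>)"
  unfolding smooth_off_origin_def
proof
  fix n
  have "C_n_on (Suc n) (-{0}) \<psi>"
    using assms unfolding smooth_off_origin_def by blast
  then show "C_n_on n (-{0}) (partial_deriv k \<psi>)" by simp
qed

lemma partial_deriv_linear_image:
  assumes "bounded_linear T" and "\<psi> differentiable (at x)"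
  shows "partial_deriv k (\<lambda>y. T (\<psi> y)) x = T (partial_deriv k \<psi> x)"
proof -
  from assms(2) have "(\<psi> has_derivative frechet_derivative \<psi> (at x)) (at x)"
    by (simp add: frechet_derivative_works)
  from bounded_linear.has_derivative[OF assms(1) this] show ?thesis
    by (simp only: partial_deriv_eq) (simp only: partial_deriv_def)
qed

lemma partial_deriv_add:
  assumes "\<psi> differentiable (at x)" and "\<phi> differentiable (at x)"
  shows "partial_deriv k (\<lambda>y. \<psi> y + \<phi> y) x = partial_deriv k \<psi> x + partial_deriv k \<phi> x"
proof -
  from assms have "(\<psi> has_derivative frechet_derivative \<psi> (at x)) (at x)"
    "(\<phi> has_derivative frechet_derivative \<phi> (at x)) (at x)"
    by (simp_all add: frechet_derivative_works)
  from has_derivative_add[OF this] show ?thesis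
    by (simp only: partial_deriv_eq) (simp only: partial_deriv_def)
qed

lemma partial_deriv_scaleR:
  assumes "(g has_derivative g') (at x)" and "\<psi> differentiable (at x)"
  shows "partial_deriv k (\<lambda>y. g y *\<^sub>R \<psi> y) x = g' (axis k 1) *\<^sub>R \<psi> x + g x *\<^sub>R partial_deriv k \<psi> x"
proof -
  from assms(2) have "(\<psi> has_derivative frechet_derivative \<psi> (at x)) (at x)"
    by (simp add: frechet_derivative_works)
  from has_derivative_scaleR[OF assms(1) this] show ?thesis
    by (simp only: partial_deriv_eq) (simp only: partial_deriv_def add.commute)
qed

lemma C_n_on_add:
  assumes "C_n_on n (-{0}) \<psi>" and "C_n_on n (-{0}) \<phi>"
  shows "C_n_on n (-{0}) (\<lambda>y. \<psi> y + \<phi> y)"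
  using assms
proof (induction n arbitrary: \<psi> \<phi>)
  case 0
  then show ?case by (auto intro: continuous_on_add)
next
  case (Suc n)
  have "C_n_on n (-{0}) (partial_deriv k (\<lambda>y. \<psi> y + \<phi> y))" for k
  proof -
    have "C_n_on n (-{0}) (\<lambda>y. partial_deriv k \<psi> y + partial_deriv k \<phi> y)"
      using Suc by simp
    then show ?thesis
      using Suc.prems by (subst C_n_on_cong[OF partial_deriv_add])
        (auto simp: differentiable_on_off_origin)
  qed
  then show ?case using Suc.prems by (auto intro: differentiable_on_add)
qed

lemma C_n_on_linear_image:
  assumes "bounded_linear T" and "C_n_on n (-{0}) \<psi>"
  shows "C_n_on n (-{0}) (\<lambda>y. T (\<psi> y))"
  using assms(2)
proof (induction n arbitrary: \<psi>)
  case 0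
  then show ?case by (auto intro: bounded_linear.continuous_on[OF assms(1)])
next
  case (Suc n)
  have "C_n_on n (-{0}) (partial_deriv k (\<lambda>y. T (\<psi> y)))" for k
  proof -
    have "C_n_on n (-{0}) (\<lambda>y. T (partial_deriv k \<psi> y))"
      using Suc by simp
    then show ?thesis
      using Suc.prems by (subst C_n_on_cong[OF partial_deriv_linear_image[OF assms(1)]])
        (auto simp: differentiable_on_off_origin)
  qed
  moreover have "(\<lambda>y. T (\<psi> y)) differentiable_on (-{0})"
    using Suc.prems
    by (auto simp: differentiable_on_off_origin
        intro: differentiable_compose[OF bounded_linear_imp_differentiable[OF assms(1)]])
  ultimately show ?case by auto
qed

text \<open>Closed under partial derivatives, so products with smooth fields are again smooth.\<close>

inductive smooth_coeff :: "(real^3 \<Rightarrow> real) \<Rightarrow> bool" where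
  const: "smooth_coeff (\<lambda>x. c)"
| coord: "smooth_coeff (\<lambda>x. x $ k)"
| inv_norm: "smooth_coeff (\<lambda>x. 1 / norm x)"
| add: "smooth_coeff f \<Longrightarrow> smooth_coeff g \<Longrightarrow> smooth_coeff (\<lambda>x. f x + g x)"
| mult: "smooth_coeff f \<Longrightarrow> smooth_coeff g \<Longrightarrow> smooth_coeff (\<lambda>x. f x * g x)"

lemma has_derivative_inverse_norm:
  assumes "x \<noteq> (0::real^3)"
  shows "((\<lambda>y. 1 / norm y) has_derivative (\<lambda>h. - (1 / norm x ^ 3) * (x \<bullet> h))) (at x)"
proof -
  have "((\<lambda>y. 1 / norm y) has_derivative (\<lambda>h. - (1 / (norm x)\<^sup>2 * (x \<bullet> h / norm x)))) (at x)"
    using assms by (auto intro!: derivative_eq_intros has_derivative_norm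
      simp: power2_eq_square sgn_div_norm divide_simps inner_commute)
  moreover have "(\<lambda>h. - (1 / (norm x)\<^sup>2 * (x \<bullet> h / norm x))) = (\<lambda>h. - (1 / norm x ^ 3) * (x \<bullet> h))"
    by (simp add: power2_eq_square power3_eq_cube)
  ultimately show ?thesis by simp
qed

text \<open>The class is closed because the gradient of \<open>1/r\<close> is
  \<open>- x / r^3\<close>, again a product of coordinates and \<open>1/r\<close>. The functions
  \<open>g' k\<close> are the components of the gradient.\<close>

lemma smooth_coeff_derivative:
  assumes "smooth_coeff g"
  shows "\<exists>g'. (\<forall>k. smooth_coeff (g' k)) \<and>
    (\<forall>x. x \<noteq> 0 \<longrightarrow> (g has_derivative (\<lambda>h. \<Sum>k\<in>UNIV. h $ k * g' k x)) (at x))"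
  using assms
proof induction
  case (const c)
  show ?case
    by (rule exI[of _ "\<lambda>k x. 0"]) (auto intro: smooth_coeff.const)
next
  case (coord k)
  have *: "(\<Sum>j\<in>UNIV. h $ j * (if j = k then 1 else 0)) = h $ k" for h :: "real^3"
    by (simp add: if_distrib cong: if_cong)
  have "((\<lambda>x. x $ k) has_derivative (\<lambda>h. h $ k)) (at x)" for x :: "real^3"
    by (rule bounded_linear_imp_has_derivative[OF bounded_linear_vec_nth])
  then show ?case
    by (intro exI[of _ "\<lambda>j x. if j = k then 1 else 0"]) (auto simp: * intro: smooth_coeff.const)
next
  case inv_norm
  \<comment> \<open>This is \<open>- x_k / r^3\<close>, spelled with three factors
    \<open>1/r\<close> so that the introduction rules of \<open>smooth_coeff\<close> apply.\<close>
  let ?g = "\<lambda>k x. (- 1) * ((1 / norm x) * ((1 / norm x) * ((1 / norm x) * x $ k)))"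
  have *: "(\<Sum>k\<in>UNIV. h $ k * ?g k x) = - (1 / norm x ^ 3) * (x \<bullet> h)" for h x :: "real^3"
    by (simp add: inner_vec_def sum_distrib_left power3_eq_cube sum_negf sum_divide_distrib mult_ac)
  show ?case
    by (rule exI[of _ ?g]) (intro conjI allI impI smooth_coeff.intros,
        unfold *, rule has_derivative_inverse_norm)
next
  case (add f g)
  then obtain f' g' where f': "\<forall>k. smooth_coeff (f' k)" "\<forall>k. smooth_coeff (g' k)"
    "\<forall>x. x \<noteq> 0 \<longrightarrow> (f has_derivative (\<lambda>h. \<Sum>k\<in>UNIV. h $ k * f' k x)) (at x)"
    "\<forall>x. x \<noteq> 0 \<longrightarrow> (g has_derivative (\<lambda>h. \<Sum>k\<in>UNIV. h $ k * g' k x)) (at x)"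
    by blast
  have "(\<lambda>h. \<Sum>k\<in>UNIV. h $ k * (f' k x + g' k x)) =
      (\<lambda>h. (\<Sum>k\<in>UNIV. h $ k * f' k x) + (\<Sum>k\<in>UNIV. h $ k * g' k x))" for x
    by (simp add: distrib_left sum.distrib)
  then show ?case
    using f' by (intro exI[of _ "\<lambda>k x. f' k x + g' k x"])
      (auto intro: smooth_coeff.add has_derivative_add)
next
  case (mult f g)
  then obtain f' g' where f': "\<forall>k. smooth_coeff (f' k)" "\<forall>k. smooth_coeff (g' k)"
    "\<forall>x. x \<noteq> 0 \<longrightarrow> (f has_derivative (\<lambda>h. \<Sum>k\<in>UNIV. h $ k * f' k x)) (at x)"
    "\<forall>x. x \<noteq> 0 \<longrightarrow> (g has_derivative (\<lambda>h. \<Sum>k\<in>UNIV. h $ k * g' k x)) (at x)"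
    by blast
  have "(\<lambda>h. \<Sum>k\<in>UNIV. h $ k * (f x * g' k x + f' k x * g x)) =
      (\<lambda>h. f x * (\<Sum>k\<in>UNIV. h $ k * g' k x) + (\<Sum>k\<in>UNIV. h $ k * f' k x) * g x)" for x
    by (simp add: algebra_simps sum.distrib sum_distrib_left)
  then have "((\<lambda>x. f x * g x) has_derivative
      (\<lambda>h. \<Sum>k\<in>UNIV. h $ k * (f x * g' k x + f' k x * g x))) (at x)" if "x \<noteq> 0" for x
    using has_derivative_mult[OF f'(3)[rule_format, OF that] f'(4)[rule_format, OF that]]
    by simp
  then show ?case
    using f'(1,2) mult.hyps by (intro exI[of _ "\<lambda>k x. f x * g' k x + f' k x * g x"])
      (simp add: smooth_coeff.add smooth_coeff.mult)
qed

text \<open>The product rule gives \<open>g' k\<close> times \<psi> plus \<open>g\<close> times a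
  derivative of \<psi>. The first term has a new coefficient, hence the induction over all
  \<open>g\<close>; in it \<psi> has one order of smoothness to spare, which
  \<open>C_n_on_mono\<close> gives away.\<close>

lemma C_n_on_coeff:
  assumes "smooth_coeff g" and "C_n_on n (-{0}) \<psi>"
  shows "C_n_on n (-{0}) (\<lambda>y. g y *\<^sub>R \<psi> y)"
  using assms
proof (induction n arbitrary: g \<psi>)
  case 0
  have "continuous_on (-{0}) g"
    using smooth_coeff_derivative[OF 0(1)]
    by (intro differentiable_imp_continuous_on)
      (auto simp: differentiable_on_off_origin differentiable_def)
  then show ?case using 0 by (auto intro: continuous_on_scaleR)
next
  case (Suc n)
  obtain g' where g': "\<forall>k. smooth_coeff (g' k)"
    "\<forall>x. x \<noteq> 0 \<longrightarrow> (g has_derivative (\<lambda>h. \<Sum>k\<in>UNIV. h $ k * g' k x)) (at x)"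
    using smooth_coeff_derivative[OF Suc.prems(1)] by blast
  have d: "\<psi> differentiable (at x)" if "x \<noteq> 0" for x
    using Suc.prems that by (simp add: differentiable_on_off_origin)
  have eq: "partial_deriv k (\<lambda>y. g y *\<^sub>R \<psi> y) x = g' k x *\<^sub>R \<psi> x + g x *\<^sub>R partial_deriv k \<psi> x"
    if "x \<noteq> 0" for k x
  proof -
    have "(\<Sum>j\<in>UNIV. axis k 1 $ j * g' j x) = g' k x"
      by (simp add: axis_def if_distrib if_distribR cong: if_cong)
    then show ?thesis
      using partial_deriv_scaleR[OF g'(2)[rule_format, OF that] d[OF that], of k] by simp
  qed
  have "C_n_on n (-{0}) (partial_deriv k (\<lambda>y. g y *\<^sub>R \<psi> y))" for k
  proof -
    have "C_n_on n (-{0}) (\<lambda>x. g' k x *\<^sub>R \<psi> x + g x *\<^sub>R partial_deriv k \<psi> x)"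
      using Suc.prems g'(1) C_n_on_mono[OF Suc.prems(2)]
      by (intro C_n_on_add Suc.IH) auto
    then show ?thesis
      using C_n_on_cong[of "partial_deriv k (\<lambda>y. g y *\<^sub>R \<psi> y)", OF eq] by blast
  qed
  moreover have "(\<lambda>y. g y *\<^sub>R \<psi> y) differentiable_on (-{0})"
    unfolding differentiable_on_off_origin
    using g'(2) d by (blast intro: differentiable_scaleR differentiableI)
  ultimately show ?case by auto
qed

lemma smooth_add: "smooth_off_origin \<psi> \<Longrightarrow> smooth_off_origin \<phi> \<Longrightarrow> smooth_off_origin (\<lambda>y. \<psi> y + \<phi> y)"
  by (auto simp: smooth_off_origin_def intro: C_n_on_add)

lemma smooth_linear_image:
  "bounded_linear T \<Longrightarrow> smooth_off_origin \<psi> \<Longrightarrow> smooth_off_origin (\<lambda>y. T (\<psi> y))"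
  by (auto simp: smooth_off_origin_def intro: C_n_on_linear_image)

lemma smooth_coeff_scaleR:
  "smooth_coeff g \<Longrightarrow> smooth_off_origin \<psi> \<Longrightarrow> smooth_off_origin (\<lambda>y. g y *\<^sub>R \<psi> y)"
  by (auto simp: smooth_off_origin_def intro: C_n_on_coeff)

section \<open>Symmetry of second derivatives\<close>

text \<open>The mean value theorem along \<open>u\<close>, applied to the increment of
  \<open>f\<close> in direction \<open>v\<close>, turns the second difference into \<open>t\<close>
  times a difference of values of \<open>f' _ u\<close>. That difference is estimated by the
  differentiability of \<open>f' _ u\<close> at the single point \<open>x\<close>.\<close>

lemma second_difference_quotient:
  fixes f :: "'a::real_normed_vector \<Rightarrow> real"
  assumes S: "open S" "x \<in> S"
    and f': "\<And>y. y \<in> S \<Longrightarrow> (f has_derivative f' y) (at y)"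
    and Du: "((\<lambda>y. f' y u) has_derivative Du) (at x)"
    and e: "e > 0"
  shows "\<exists>d>0. \<forall>t. 0 < t \<and> t < d \<longrightarrow>
    \<bar>(f (x + t *\<^sub>R u + t *\<^sub>R v) - f (x + t *\<^sub>R u) - f (x + t *\<^sub>R v) + f x) / t\<^sup>2 - Du v\<bar> \<le> e"
proof -
  define N where "N = norm u + norm v + 1"
  have N: "N > 0" "norm u + norm v \<le> N" by (simp_all add: N_def add_nonneg_pos)
  \<comment> \<open>Two linearization errors occur, each at most \<open>e' * (t * N)\<close>; after
    division by \<open>t\<close> they add up to \<open>e\<close>.\<close>
  define e' where "e' = e / (2 * N)"
  have e': "e' > 0" "2 * (e' * N) = e" using e N by (simp_all add: e'_def)
  obtain r where r: "r > 0" "ball x r \<subseteq> S"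
    using S by (auto simp: open_contains_ball)
  obtain d where d: "d > 0"
    "\<And>y. norm (y - x) < d \<Longrightarrow> \<bar>f' y u - f' x u - Du (y - x)\<bar> \<le> e' * norm (y - x)"
    using Du e'(1) unfolding has_derivative_at_alt real_norm_def by blast
  interpret Du: bounded_linear Du using Du by (rule has_derivative_bounded_linear)
  show ?thesis
  proof (intro exI conjI allI impI)
    show "0 < min r d / N" using r d N by simp
    fix t assume t: "0 < t \<and> t < min r d / N"
    then have tN: "t * N < r" "t * N < d" "t > 0" using N by (simp_all add: pos_less_divide_eq)
    have near: "norm (s *\<^sub>R u + b *\<^sub>R v) \<le> t * N" if "0 \<le> s" "s \<le> t" "0 \<le> b" "b \<le> t" for s b
    proof -
      have "norm (s *\<^sub>R u + b *\<^sub>R v) \<le> s * norm u + b * norm v"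
        using norm_triangle_ineq[of "s *\<^sub>R u" "b *\<^sub>R v"] that by simp
      also have "\<dots> \<le> t * norm u + t * norm v"
        using that by (intro add_mono mult_right_mono) auto
      also have "\<dots> \<le> t * N" using N(2) tN(3) by (simp flip: distrib_left)
      finally show ?thesis .
    qed
    have inS: "x + s *\<^sub>R u + b *\<^sub>R v \<in> S" if "0 \<le> s" "s \<le> t" "0 \<le> b" "b \<le> t" for s b
      using near[OF that] r(2) tN(1) by (auto simp: dist_norm add.assoc norm_minus_commute subset_iff)
    define g where "g s = f (x + s *\<^sub>R u + t *\<^sub>R v) - f (x + s *\<^sub>R u)" for s
    define g' where "g' s = f' (x + s *\<^sub>R u + t *\<^sub>R v) u - f' (x + s *\<^sub>R u) u" for s
    have line: "((\<lambda>s. f (x + s *\<^sub>R u + b *\<^sub>R v)) has_real_derivative f' (x + s *\<^sub>R u + b *\<^sub>R v) u) (at s)"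
      if "0 \<le> s" "s \<le> t" "0 \<le> b" "b \<le> t" for s b
    proof -
      have "((\<lambda>s. x + s *\<^sub>R u + b *\<^sub>R v) has_derivative (\<lambda>h. h *\<^sub>R u)) (at s)"
        by (auto intro!: derivative_eq_intros)
      from diff_chain_at[OF this f'[OF inS[OF that]]]
      have "((\<lambda>s. f (x + s *\<^sub>R u + b *\<^sub>R v)) has_derivative
          (\<lambda>h. f' (x + s *\<^sub>R u + b *\<^sub>R v) (h *\<^sub>R u))) (at s)"
        by (simp add: o_def)
      moreover have "linear (f' (x + s *\<^sub>R u + b *\<^sub>R v))"
        using f'[OF inS[OF that]] has_derivative_linear by blast
      ultimately show ?thesis
        by (simp add: has_field_derivative_def linear_scale mult_commute_abs)
    qed
    have "(g has_real_derivative g' s) (at s)" if "0 \<le> s" "s \<le> t" for s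
      unfolding g_def g'_def using line[OF that, of t] line[OF that, of 0] tN(3)
      by (auto intro!: DERIV_diff)
    from MVT2[OF tN(3) this] obtain z where z: "0 < z" "z < t" "g t - g 0 = t * g' z"
      by auto
    let ?y1 = "x + z *\<^sub>R u + t *\<^sub>R v" and ?y2 = "x + z *\<^sub>R u"
    have y: "norm (?y1 - x) \<le> t * N" "norm (?y2 - x) \<le> t * N"
      using near[of z t] near[of z 0] z by (simp_all add: add.assoc)
    have "\<bar>f' ?y1 u - f' x u - Du (?y1 - x)\<bar> \<le> e' * (t * N)"
      using d(2)[of ?y1] y(1) tN(2) e'(1) by (meson le_less_trans mult_left_mono order.trans less_imp_le)
    moreover have "\<bar>f' ?y2 u - f' x u - Du (?y2 - x)\<bar> \<le> e' * (t * N)"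
      using d(2)[of ?y2] y(2) tN(2) e'(1) by (meson le_less_trans mult_left_mono order.trans less_imp_le)
    moreover have "Du (?y1 - x) - Du (?y2 - x) = t * Du v"
      by (simp add: Du.add Du.scaleR add.assoc)
    ultimately have "\<bar>g' z - t * Du v\<bar> \<le> 2 * (e' * (t * N))"
      unfolding g'_def by linarith
    then have "\<bar>g' z / t - Du v\<bar> \<le> e"
    proof -
      have "g' z / t - Du v = (g' z - t * Du v) / t" using tN(3) by (simp add: field_simps)
      then have "\<bar>g' z / t - Du v\<bar> = \<bar>g' z - t * Du v\<bar> / t" using tN(3) by (simp add: abs_divide)
      also have "\<dots> \<le> 2 * (e' * (t * N)) / t"
        using \<open>\<bar>g' z - t * Du v\<bar> \<le> 2 * (e' * (t * N))\<close> tN(3)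
        by (intro divide_right_mono) auto
      also have "\<dots> = e" using tN(3) e'(2) by (simp add: field_simps)
      finally show ?thesis .
    qed
    moreover have "(g t - g 0) / t\<^sup>2 = g' z / t"
      using z(3) tN(3) by (simp add: power2_eq_square)
    ultimately show "\<bar>(f (x + t *\<^sub>R u + t *\<^sub>R v) - f (x + t *\<^sub>R u) - f (x + t *\<^sub>R v) + f x) / t\<^sup>2 - Du v\<bar> \<le> e"
      by (simp add: g_def algebra_simps)
  qed
qed

text \<open>The second difference is symmetric in \<open>u\<close> and \<open>v\<close>, while its
  quotient by \<open>t^2\<close> is close to \<open>Du v\<close> in one reading and to
  \<open>Dv u\<close> in the other.\<close>

lemma second_derivative_symmetric:
  fixes f :: "'a::real_normed_vector \<Rightarrow> real"
  assumes S: "open S" "x \<in> S"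
    and f': "\<And>y. y \<in> S \<Longrightarrow> (f has_derivative f' y) (at y)"
    and Du: "((\<lambda>y. f' y u) has_derivative Du) (at x)"
    and Dv: "((\<lambda>y. f' y v) has_derivative Dv) (at x)"
  shows "Du v = Dv u"
proof (rule ccontr)
  assume "Du v \<noteq> Dv u"
  \<comment> \<open>A third of the gap: two approximations within \<open>e\<close> of the same
    quotient would give \<open>3 * e \<le> 2 * e\<close>.\<close>
  define e where "e = \<bar>Du v - Dv u\<bar> / 3"
  have e: "e > 0" using \<open>Du v \<noteq> Dv u\<close> by (simp add: e_def)
  let ?q = "\<lambda>t. (f (x + t *\<^sub>R u + t *\<^sub>R v) - f (x + t *\<^sub>R u) - f (x + t *\<^sub>R v) + f x) / t\<^sup>2"
  obtain d1 where d1: "d1 > 0" "\<And>t. 0 < t \<Longrightarrow> t < d1 \<Longrightarrow> \<bar>?q t - Du v\<bar> \<le> e"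
    using second_difference_quotient[OF S f' Du e, of v] by blast
  obtain d2 where d2: "d2 > 0" "\<And>t. 0 < t \<Longrightarrow> t < d2 \<Longrightarrow>
      \<bar>(f (x + t *\<^sub>R v + t *\<^sub>R u) - f (x + t *\<^sub>R v) - f (x + t *\<^sub>R u) + f x) / t\<^sup>2 - Dv u\<bar> \<le> e"
    using second_difference_quotient[OF S f' Dv e, of u] by blast
  define t where "t = min d1 d2 / 2"
  have t: "0 < t" "t < d1" "t < d2" using d1(1) d2(1) by (auto simp: t_def min_def)
  have "(f (x + t *\<^sub>R v + t *\<^sub>R u) - f (x + t *\<^sub>R v) - f (x + t *\<^sub>R u) + f x) / t\<^sup>2 = ?q t"
    by (simp add: algebra_simps)
  with d1(2)[OF t(1,2)] d2(2)[OF t(1,3)] have "\<bar>Du v - Dv u\<bar> \<le> 2 * e" by linarith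
  then show False using e by (simp add: e_def)
qed

lemma bounded_linear_component:
  "bounded_linear (\<lambda>v::spinor. Re (v $ c))" "bounded_linear (\<lambda>v::spinor. Im (v $ c))"
  by (intro bounded_linear_compose[OF bounded_linear_Re bounded_linear_vec_nth]
      bounded_linear_compose[OF bounded_linear_Im bounded_linear_vec_nth])+

text \<open>The symmetry result rests on the mean value theorem for real functions, so it is applied
  to the real and imaginary part of each component.\<close>

lemma partial_deriv_commute:
  assumes "smooth_off_origin \<psi>" and "x \<noteq> 0"
  shows "partial_deriv j (partial_deriv k \<psi>) x = partial_deriv k (partial_deriv j \<psi>) x"
proof -
  have *: "T (partial_deriv j (partial_deriv k \<psi>) x) = T (partial_deriv k (partial_deriv j \<psi>) x)"
    if T: "bounded_linear T" for T :: "spinor \<Rightarrow> real"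
  proof -
    have 1: "((\<lambda>y. T (\<psi> y)) has_derivative (\<lambda>h. T (frechet_derivative \<psi> (at y) h))) (at y)"
      if "y \<in> -{0}" for y
      using bounded_linear.has_derivative[OF T] smooth_imp_differentiable[OF assms(1), of y] that
      unfolding frechet_derivative_works by blast
    have 2: "((\<lambda>y. T (frechet_derivative \<psi> (at y) (axis i 1))) has_derivative
        (\<lambda>h. T (frechet_derivative (partial_deriv i \<psi>) (at x) h))) (at x)" for i
      using bounded_linear.has_derivative[OF T]
        smooth_imp_differentiable[OF smooth_partial_deriv[OF assms(1)] assms(2), of i]
      unfolding frechet_derivative_works partial_deriv_def by blast
    have "open (-{0::real^3})" by auto
    from second_derivative_symmetric[OF this _ 1 2[of j] 2[of k]] assms(2) show ?thesis
      by (simp add: partial_deriv_def)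
  qed
  show ?thesis
    by (simp add: vec_eq_iff complex_eq_iff *[OF bounded_linear_component(1)]
        *[OF bounded_linear_component(2)])
qed

section \<open>The ring of smooth operators\<close>

text \<open>These conditions make the operators modulo \<open>\<doteq>\<close> a ring. A product
  respects \<open>\<doteq>\<close> if its right factor preserves smoothness and its left factor
  ignores the value at the origin; additivity gives left distributivity, and homogeneity makes
  scalars central.\<close>

definition smooth_op :: "spinor_op \<Rightarrow> bool" where
  "smooth_op A \<longleftrightarrow>
    (\<forall>\<psi>. smooth_off_origin \<psi> \<longrightarrow> smooth_off_origin (A \<psi>)) \<and>
    (\<forall>\<psi> \<phi> x. smooth_off_origin \<psi> \<longrightarrow> (\<forall>y. y \<noteq> 0 \<longrightarrow> \<psi> y = \<phi> y) \<longrightarrow> x \<noteq> 0 \<longrightarrow> A \<psi> x = A \<phi> x) \<and>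
    (\<forall>\<psi> \<phi> x. smooth_off_origin \<psi> \<longrightarrow> smooth_off_origin \<phi> \<longrightarrow> x \<noteq> 0 \<longrightarrow>
      A (\<lambda>y. \<psi> y + \<phi> y) x = A \<psi> x + A \<phi> x) \<and>
    (\<forall>\<psi> c x. smooth_off_origin \<psi> \<longrightarrow> x \<noteq> 0 \<longrightarrow> A (\<lambda>y. c *s \<psi> y) x = c *s A \<psi> x)"

lemma smooth_opI:
  assumes "\<And>\<psi>. smooth_off_origin \<psi> \<Longrightarrow> smooth_off_origin (A \<psi>)"
    and "\<And>\<psi> \<phi> x. smooth_off_origin \<psi> \<Longrightarrow> (\<And>y. y \<noteq> 0 \<Longrightarrow> \<psi> y = \<phi> y) \<Longrightarrow> x \<noteq> 0 \<Longrightarrow> A \<psi> x = A \<phi> x"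
    and "\<And>\<psi> \<phi> x. smooth_off_origin \<psi> \<Longrightarrow> smooth_off_origin \<phi> \<Longrightarrow> x \<noteq> 0 \<Longrightarrow>
      A (\<lambda>y. \<psi> y + \<phi> y) x = A \<psi> x + A \<phi> x"
    and "\<And>\<psi> c x. smooth_off_origin \<psi> \<Longrightarrow> x \<noteq> 0 \<Longrightarrow> A (\<lambda>y. c *s \<psi> y) x = c *s A \<psi> x"
  shows "smooth_op A"
  using assms unfolding smooth_op_def by blast

lemma
  assumes "smooth_op A" and "smooth_off_origin \<psi>"
  shows smooth_op_smooth: "smooth_off_origin (A \<psi>)"
    and smooth_op_cong: "(\<And>y. y \<noteq> 0 \<Longrightarrow> \<psi> y = \<phi> y) \<Longrightarrow> x \<noteq> 0 \<Longrightarrow> A \<psi> x = A \<phi> x"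
    and smooth_op_add: "smooth_off_origin \<phi> \<Longrightarrow> x \<noteq> 0 \<Longrightarrow> A (\<lambda>y. \<psi> y + \<phi> y) x = A \<psi> x + A \<phi> x"
    and smooth_op_scale: "x \<noteq> 0 \<Longrightarrow> A (\<lambda>y. c *s \<psi> y) x = c *s A \<psi> x"
  using assms unfolding smooth_op_def by blast+

lemma smooth_op_smooth_cong:
  assumes "\<And>\<psi> x. x \<noteq> 0 \<Longrightarrow> A \<psi> x = B \<psi> x" and "smooth_op B"
  shows "smooth_op A"
proof (rule smooth_opI)
  fix \<psi> assume s: "smooth_off_origin \<psi>"
  show "smooth_off_origin (A \<psi>)"
    using smooth_cong[of "A \<psi>" "B \<psi>"] assms(1) smooth_op_smooth[OF assms(2) s] by blast
next
  fix \<psi> \<phi> :: "real^3 \<Rightarrow> spinor" and x :: "real^3"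
  assume "smooth_off_origin \<psi>" "\<And>y. y \<noteq> 0 \<Longrightarrow> \<psi> y = \<phi> y" "x \<noteq> 0"
  then show "A \<psi> x = A \<phi> x" using smooth_op_cong[OF assms(2)] assms(1) by metis
qed (simp_all add: assms(1) smooth_op_add[OF assms(2)] smooth_op_scale[OF assms(2)])

lemma bounded_linear_vector_scale: "bounded_linear (\<lambda>v::spinor. c *s v)"
  by (rule linear_conv_bounded_linear[THEN iffD1], rule linearI)
    (simp_all add: vec_eq_iff complex_eq_iff algebra_simps)

lemma bounded_linear_matrix: "bounded_linear (\<lambda>v::spinor. M *v v)"
  by (rule linear_conv_bounded_linear[THEN iffD1], rule linearI)
    (simp_all add: vec_eq_iff matrix_vector_mult_def distrib_left sum.distrib scaleR_sum_right)

lemma scaleR_eq_vector_scale: "r *\<^sub>R v = complex_of_real r *s (v :: spinor)"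
  by (simp add: vec_eq_iff complex_eq_iff)

lemma op_apply:
  "(A + B :: spinor_op) \<psi> x = A \<psi> x + B \<psi> x"
  "(A - B :: spinor_op) \<psi> x = A \<psi> x - B \<psi> x"
  "(- A :: spinor_op) \<psi> x = - A \<psi> x"
  "(0 :: spinor_op) \<psi> x = 0"
  "(c *\<^sub>o A) \<psi> x = c *s A \<psi> x"
  by (simp_all add: op_scale_def)

lemma smooth_op_id: "smooth_op id"
  by (rule smooth_opI) auto

lemma smooth_op_0: "smooth_op 0"
proof (rule smooth_opI)
  fix \<psi> :: "real^3 \<Rightarrow> spinor" assume "smooth_off_origin \<psi>"
  from smooth_linear_image[OF bounded_linear_zero this] show "smooth_off_origin (0 \<psi>)"
    by (simp add: zero_fun_def)
qed auto

lemma smooth_op_comp: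
  assumes A: "smooth_op A" and B: "smooth_op B" shows "smooth_op (A \<cdot> B)"
proof (rule smooth_opI)
  fix \<psi> assume s: "smooth_off_origin \<psi>"
  show "smooth_off_origin ((A \<cdot> B) \<psi>)"
    using smooth_op_smooth[OF A smooth_op_smooth[OF B s]] by simp
next
  fix \<psi> \<phi> :: "real^3 \<Rightarrow> spinor" and x :: "real^3"
  assume s: "smooth_off_origin \<psi>" and eq: "\<And>y. y \<noteq> 0 \<Longrightarrow> \<psi> y = \<phi> y" and x: "x \<noteq> 0"
  have "B \<psi> y = B \<phi> y" if "y \<noteq> 0" for y
    by (rule smooth_op_cong[OF B s eq that])
  then show "(A \<cdot> B) \<psi> x = (A \<cdot> B) \<phi> x"
    unfolding comp_apply by (rule smooth_op_cong[OF A smooth_op_smooth[OF B s] _ x])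
next
  fix \<psi> \<phi> :: "real^3 \<Rightarrow> spinor" and x :: "real^3"
  assume s: "smooth_off_origin \<psi>" "smooth_off_origin \<phi>" and x: "x \<noteq> 0"
  have "A (B (\<lambda>y. \<psi> y + \<phi> y)) x = A (\<lambda>y. B \<psi> y + B \<phi> y) x"
    by (rule smooth_op_cong[OF A smooth_op_smooth[OF B smooth_add[OF s]] smooth_op_add[OF B s] x])
  then show "(A \<cdot> B) (\<lambda>y. \<psi> y + \<phi> y) x = (A \<cdot> B) \<psi> x + (A \<cdot> B) \<phi> x"
    using smooth_op_add[OF A smooth_op_smooth[OF B s(1)] smooth_op_smooth[OF B s(2)] x] by simp
next
  fix \<psi> :: "real^3 \<Rightarrow> spinor" and c and x :: "real^3"
  assume s: "smooth_off_origin \<psi>" and x: "x \<noteq> 0"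
  have "A (B (\<lambda>y. c *s \<psi> y)) x = A (\<lambda>y. c *s B \<psi> y) x"
    by (rule smooth_op_cong[OF A
          smooth_op_smooth[OF B smooth_linear_image[OF bounded_linear_vector_scale s]]
          smooth_op_scale[OF B s] x])
  then show "(A \<cdot> B) (\<lambda>y. c *s \<psi> y) x = c *s (A \<cdot> B) \<psi> x"
    using smooth_op_scale[OF A smooth_op_smooth[OF B s] x] by simp
qed

lemma smooth_op_plus:
  assumes A: "smooth_op A" and B: "smooth_op B" shows "smooth_op (A + B)"
proof (rule smooth_opI)
  fix \<psi> assume s: "smooth_off_origin \<psi>"
  show "smooth_off_origin ((A + B) \<psi>)"
    using smooth_add[OF smooth_op_smooth[OF A s] smooth_op_smooth[OF B s]] by (simp add: plus_fun_def)
next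
  fix \<psi> \<phi> :: "real^3 \<Rightarrow> spinor" and x :: "real^3"
  assume s: "smooth_off_origin \<psi>" and "\<And>y. y \<noteq> 0 \<Longrightarrow> \<psi> y = \<phi> y" "x \<noteq> 0"
  then show "(A + B) \<psi> x = (A + B) \<phi> x"
    using smooth_op_cong[OF A s, of \<phi> x] smooth_op_cong[OF B s, of \<phi> x] by (simp add: op_apply)
qed (simp_all add: op_apply smooth_op_add[OF A] smooth_op_add[OF B] smooth_op_scale[OF A]
    smooth_op_scale[OF B] vector_add_ldistrib)

lemma smooth_op_op_scale:
  assumes A: "smooth_op A" shows "smooth_op (c *\<^sub>o A)"
proof (rule smooth_opI)
  fix \<psi> assume s: "smooth_off_origin \<psi>"
  show "smooth_off_origin ((c *\<^sub>o A) \<psi>)"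
    using smooth_linear_image[OF bounded_linear_vector_scale smooth_op_smooth[OF A s]]
    by (simp add: op_scale_def)
next
  fix \<psi> \<phi> :: "real^3 \<Rightarrow> spinor" and x :: "real^3"
  assume s: "smooth_off_origin \<psi>" and "\<And>y. y \<noteq> 0 \<Longrightarrow> \<psi> y = \<phi> y" "x \<noteq> 0"
  then show "(c *\<^sub>o A) \<psi> x = (c *\<^sub>o A) \<phi> x"
    using smooth_op_cong[OF A s, of \<phi> x] by (simp add: op_apply)
qed (simp_all add: op_apply smooth_op_add[OF A] smooth_op_scale[OF A]
    vector_add_ldistrib vector_smult_assoc mult.commute)

lemma uminus_eq_op_scale: "- A = (- 1) *\<^sub>o (A :: spinor_op)"
  by (simp add: fun_eq_iff op_apply vec_eq_iff)

lemma smooth_op_uminus: "smooth_op A \<Longrightarrow> smooth_op (- A)"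
  by (simp add: uminus_eq_op_scale smooth_op_op_scale)

lemma smooth_op_minus: "smooth_op A \<Longrightarrow> smooth_op B \<Longrightarrow> smooth_op (A - B)"
  using smooth_op_plus[OF _ smooth_op_uminus, of A B] by simp

lemma smooth_op_sum_3: "(\<And>k. smooth_op (A k)) \<Longrightarrow> smooth_op (\<Sum>k\<in>(UNIV::3 set). A k)"
  by (simp add: sum_3 smooth_op_plus)

lemma smooth_op_partial_deriv: "smooth_op (partial_deriv k)"
proof (rule smooth_opI)
  fix \<psi> :: "real^3 \<Rightarrow> spinor" and c and x :: "real^3"
  assume s: "smooth_off_origin \<psi>" and x: "x \<noteq> 0"
  show "partial_deriv k (\<lambda>y. c *s \<psi> y) x = c *s partial_deriv k \<psi> x"
    by (rule partial_deriv_linear_image[OF bounded_linear_vector_scale smooth_imp_differentiable[OF s x]])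
qed (auto intro: smooth_partial_deriv partial_deriv_cong partial_deriv_add smooth_imp_differentiable)

lemma smooth_op_matrix: "smooth_op (\<lambda>\<psi> x. M *v \<psi> x)"
proof (rule smooth_opI)
  fix \<psi> :: "real^3 \<Rightarrow> spinor" assume s: "smooth_off_origin \<psi>"
  show "smooth_off_origin (\<lambda>x. M *v \<psi> x)"
    by (rule smooth_linear_image[OF bounded_linear_matrix s])
qed (simp_all add: matrix_vector_right_distrib vector_scalar_commute)

lemma smooth_op_coeff:
  assumes "smooth_coeff g" shows "smooth_op (\<lambda>\<psi> x. complex_of_real (g x) *s \<psi> x)"
proof (rule smooth_opI)
  fix \<psi> :: "real^3 \<Rightarrow> spinor" assume s: "smooth_off_origin \<psi>"
  show "smooth_off_origin (\<lambda>x. complex_of_real (g x) *s \<psi> x)"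
    using smooth_coeff_scaleR[OF assms s] by (simp add: scaleR_eq_vector_scale)
qed (simp_all add: vector_add_ldistrib vector_smult_assoc mult.commute)

lemma smooth_op_pos: "smooth_op (pos k)"
  by (rule smooth_op_smooth_cong[OF _ smooth_op_coeff[OF smooth_coeff.coord[of k]]]) (simp add: pos_def)

lemma smooth_op_radial:
  assumes "smooth_coeff g" and "\<And>x. x \<noteq> 0 \<Longrightarrow> f (norm x) = g x"
  shows "smooth_op (radial f)"
  by (rule smooth_op_smooth_cong[OF _ smooth_op_coeff[OF assms(1)]]) (simp add: radial_def assms(2))

lemma smooth_op_inv_r: "smooth_op inv_r"
  by (rule smooth_op_radial[OF smooth_coeff.inv_norm]) simp

lemma norm_sq_3: "(norm (x :: real^3))\<^sup>2 = x $ 1 * x $ 1 + x $ 2 * x $ 2 + x $ 3 * x $ 3"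
  by (simp add: power2_norm_eq_inner inner_vec_def sum_3)

lemma smooth_op_linear_radial: "smooth_op (radial (\<lambda>r. a + b * r))"
proof (rule smooth_op_radial)
  \<comment> \<open>The norm is not among the generators of \<open>smooth_coeff\<close>; off the
    origin it is \<open>r^2 * (1/r)\<close> with \<open>r^2\<close> a polynomial in the
    coordinates.\<close>
  show "smooth_coeff (\<lambda>x. a + b * ((x $ 1 * x $ 1 + x $ 2 * x $ 2 + x $ 3 * x $ 3) * (1 / norm x)))"
    by (intro smooth_coeff.intros)
  show "a + b * norm x = a + b * ((x $ 1 * x $ 1 + x $ 2 * x $ 2 + x $ 3 * x $ 3) * (1 / norm x))"
    if "x \<noteq> 0" for x :: "real^3"
    using that by (simp flip: norm_sq_3 add: power2_eq_square)
qed

lemma smooth_op_inv_sq: "smooth_op (radial (\<lambda>r. c / (d * r\<^sup>2)))"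
proof (rule smooth_op_radial)
  show "smooth_coeff (\<lambda>x. c / d * (1 / norm x * (1 / norm x)))"
    by (intro smooth_coeff.intros)
qed (simp add: power2_eq_square)

lemma smooth_op_sigma: "smooth_op (sigma1 k)" "smooth_op (sigma2 k)"
  using smooth_op_matrix unfolding sigma1_def[abs_def] sigma2_def[abs_def] by blast+

lemma smooth_op_inner: "(\<And>k. smooth_op (A k)) \<Longrightarrow> (\<And>k. smooth_op (B k)) \<Longrightarrow> smooth_op (op_inner A B)"
  unfolding op_inner_def by (intro smooth_op_sum_3 smooth_op_comp)

lemma smooth_op_cross: "(\<And>k. smooth_op (A k)) \<Longrightarrow> (\<And>k. smooth_op (B k)) \<Longrightarrow> smooth_op (op_cross A B k)"
  unfolding op_cross_def by (intro smooth_op_minus smooth_op_comp)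

lemma smooth_op_mom: "smooth_op (mom h k)"
  unfolding mom_def by (intro smooth_op_op_scale smooth_op_partial_deriv)

lemma smooth_op_ang_mom: "smooth_op (ang_mom h k)"
  unfolding ang_mom_def by (intro smooth_op_cross smooth_op_pos smooth_op_mom)

lemma smooth_op_tot_ang_mom: "smooth_op (tot_ang_mom h k)"
  unfolding tot_ang_mom_def
  by (intro smooth_op_plus smooth_op_op_scale smooth_op_sigma smooth_op_ang_mom)

lemmas smooth_op_intros [simp, intro] =
  smooth_op_id smooth_op_0 smooth_op_comp smooth_op_plus smooth_op_minus smooth_op_uminus
  smooth_op_op_scale smooth_op_inner smooth_op_cross smooth_op_partial_deriv smooth_op_pos
  smooth_op_inv_r smooth_op_linear_radial smooth_op_inv_sq smooth_op_sigma smooth_op_mom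
  smooth_op_ang_mom smooth_op_tot_ang_mom

lemma op_eq_comp:
  assumes "smooth_op A" "smooth_op A'" "smooth_op B" "smooth_op B'" "A \<doteq> A'" "B \<doteq> B'"
  shows "A \<cdot> B \<doteq> A' \<cdot> B'"
  unfolding op_eq_def
proof (intro allI impI)
  fix \<psi> :: "real^3 \<Rightarrow> spinor" and x :: "real^3"
  assume s: "smooth_off_origin \<psi>" and x: "x \<noteq> 0"
  have "A (B \<psi>) x = A' (B \<psi>) x"
    using assms(5) smooth_op_smooth[OF assms(3) s] x by (auto simp: op_eq_def)
  also have "\<dots> = A' (B' \<psi>) x"
    using smooth_op_cong[OF assms(2) smooth_op_smooth[OF assms(3) s], of "B' \<psi>" x] assms(6) s x
    by (auto simp: op_eq_def)
  finally show "(A \<cdot> B) \<psi> x = (A' \<cdot> B') \<psi> x" by simp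
qed

lemma op_eq_comp_add:
  assumes "smooth_op A" "smooth_op B" "smooth_op C"
  shows "A \<cdot> (B + C) \<doteq> A \<cdot> B + A \<cdot> C"
  using assms by (simp add: op_eq_def op_apply plus_fun_def smooth_op_add smooth_op_smooth)

\<comment> \<open>The quotient is partial since \<open>\<doteq>\<close> is a congruence for products
  only among smooth operators. A Hamiltonian with a merely differentiable potential therefore has no
  meaningful image; in the ring only potentials \<open>a + b * r\<close> are treated.\<close>
quotient_type sop = spinor_op / partial: "\<lambda>A B. smooth_op A \<and> smooth_op B \<and> A \<doteq> B"
  by (rule part_equivpI) (auto simp: symp_def transp_def op_eq_def)

instantiation sop :: ring_1
begin

lift_definition zero_sop :: sop is 0 by (simp add: op_eq_def)
lift_definition one_sop :: sop is id by (simp add: op_eq_def)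
lift_definition plus_sop :: "sop \<Rightarrow> sop \<Rightarrow> sop" is "(+)" by (auto simp: op_eq_def op_apply)
lift_definition minus_sop :: "sop \<Rightarrow> sop \<Rightarrow> sop" is "(-)" by (auto simp: op_eq_def op_apply)
lift_definition uminus_sop :: "sop \<Rightarrow> sop" is uminus by (auto simp: op_eq_def op_apply)
lift_definition times_sop :: "sop \<Rightarrow> sop \<Rightarrow> sop" is "(\<circ>)" by (intro conjI smooth_op_comp op_eq_comp) auto

lemma smooth_const: "smooth_off_origin (\<lambda>x. v)"
proof -
  have "C_n_on n (-{0}) (\<lambda>x. v)" for n
  proof (induction n arbitrary: v)
    case (Suc n)
    have "partial_deriv k (\<lambda>x. v) = (\<lambda>x. 0)" for k by (simp add: fun_eq_iff partial_deriv_def)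
    then show ?case using Suc by simp
  qed simp
  then show ?thesis by (simp add: smooth_off_origin_def)
qed

instance
proof
  have "\<not> (0 :: spinor_op) \<doteq> id"
  proof
    assume "(0 :: spinor_op) \<doteq> id"
    then have "(0 :: spinor_op) (\<lambda>x. v) y = id (\<lambda>x. v) y" if "y \<noteq> 0" for v y
      using smooth_const that unfolding op_eq_def by blast
    from this[of "axis 1 1" "axis (1,1) 1"] show False
      by (simp add: axis_eq_0_iff)
  qed
  then show "(0::sop) \<noteq> 1" by transfer blast
next
  fix a b c :: sop
  show "a * (b + c) = a * b + a * c"
    by transfer (simp add: op_eq_comp_add)
qed (transfer; force simp: op_eq_def op_apply)+

end

section \<open>Passing between operators, ring elements and spinor components\<close>

lemma abs_sop_eq_iff:
  "smooth_op A \<Longrightarrow> smooth_op B \<Longrightarrow> abs_sop A = abs_sop B \<longleftrightarrow> A \<doteq> B"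
  using Quotient3_rel[OF Quotient3_sop, of A B] by (auto simp: op_eq_def)

lemma abs_sop_hom:
  "smooth_op A \<Longrightarrow> smooth_op B \<Longrightarrow> abs_sop (A \<cdot> B) = abs_sop A * abs_sop B"
  "smooth_op A \<Longrightarrow> smooth_op B \<Longrightarrow> abs_sop (A + B) = abs_sop A + abs_sop B"
  "smooth_op A \<Longrightarrow> smooth_op B \<Longrightarrow> abs_sop (A - B) = abs_sop A - abs_sop B"
  "smooth_op A \<Longrightarrow> abs_sop (- A) = - abs_sop A"
  "abs_sop 0 = 0" "abs_sop id = 1"
  by (simp_all add: times_sop.abs_eq plus_sop.abs_eq minus_sop.abs_eq uminus_sop.abs_eq
      zero_sop_def one_sop_def op_eq_def)

definition scal :: "complex \<Rightarrow> sop" where "scal c = abs_sop (c *\<^sub>o id)"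

lemma abs_sop_scale:
  assumes "smooth_op A" shows "abs_sop (c *\<^sub>o A) = scal c * abs_sop A"
proof -
  have "c *\<^sub>o A = (c *\<^sub>o id) \<cdot> A" by (simp add: fun_eq_iff op_apply)
  then show ?thesis using assms by (simp only: scal_def abs_sop_hom smooth_op_intros)
qed

lemma abs_sop_inner:
  "(\<And>k. smooth_op (A k)) \<Longrightarrow> (\<And>k. smooth_op (B k)) \<Longrightarrow>
    abs_sop (op_inner A B) = abs_sop (A 1) * abs_sop (B 1) + abs_sop (A 2) * abs_sop (B 2)
      + abs_sop (A 3) * abs_sop (B 3)"
  by (simp add: op_inner_def sum_3 abs_sop_hom)

lemma abs_sop_cross:
  "(\<And>k. smooth_op (A k)) \<Longrightarrow> (\<And>k. smooth_op (B k)) \<Longrightarrow>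
    abs_sop (op_cross A B k) = abs_sop (A (k + 1)) * abs_sop (B (k + 2)) - abs_sop (A (k + 2)) * abs_sop (B (k + 1))"
  by (simp add: op_cross_def abs_sop_hom)

text \<open>The value 0 at the origin and on fields that are not smooth makes the evaluation rules
  below unconditional, so they serve as plain rewrite rules.\<close>

definition eval :: "sop \<Rightarrow> (real^3 \<Rightarrow> spinor) \<Rightarrow> real^3 \<Rightarrow> 2 \<times> 2 \<Rightarrow> complex" where
  "eval P \<psi> x c = (if smooth_off_origin \<psi> \<and> x \<noteq> 0 then rep_sop P \<psi> x $ c else 0)"

lemma smooth_op_rep_sop [simp]: "smooth_op (rep_sop P)"
  using Quotient3_rep_reflp[OF Quotient3_sop, of P] by simp

lemma abs_rep_sop [simp]: "abs_sop (rep_sop P) = P"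
  by (rule Quotient3_abs_rep[OF Quotient3_sop])

lemma rep_abs_sop:
  assumes "smooth_op A" "smooth_off_origin \<psi>" "x \<noteq> 0"
  shows "rep_sop (abs_sop A) \<psi> x = A \<psi> x"
  using abs_sop_eq_iff[of "rep_sop (abs_sop A)" A] assms by (simp add: op_eq_def)

lemma sop_eqI:
  assumes "\<And>\<psi> x i j. smooth_off_origin \<psi> \<Longrightarrow> x \<noteq> 0 \<Longrightarrow> eval P \<psi> x (i, j) = eval Q \<psi> x (i, j)"
  shows "P = Q"
proof -
  have "rep_sop P \<doteq> rep_sop Q"
    using assms by (auto simp: op_eq_def vec_eq_iff eval_def)
  then show ?thesis
    using abs_sop_eq_iff[of "rep_sop P" "rep_sop Q"] by simp
qed

text \<open>The Pauli rules in \<open>eval_sigma\<close> match only literal indices 1 and 2, so the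
  component index is split into its four cases beforehand.\<close>

lemma sop_eqI_components:
  assumes "\<And>\<psi> x. smooth_off_origin \<psi> \<Longrightarrow> x \<noteq> 0 \<Longrightarrow>
    eval P \<psi> x (1, 1) = eval Q \<psi> x (1, 1) \<and> eval P \<psi> x (1, 2) = eval Q \<psi> x (1, 2) \<and>
    eval P \<psi> x (2, 1) = eval Q \<psi> x (2, 1) \<and> eval P \<psi> x (2, 2) = eval Q \<psi> x (2, 2)"
  shows "P = Q"
proof (rule sop_eqI)
  fix \<psi> and x :: "real^3" and i j :: 2
  assume "smooth_off_origin \<psi>" "x \<noteq> 0"
  with assms show "eval P \<psi> x (i, j) = eval Q \<psi> x (i, j)"
    using exhaust_2[of i] exhaust_2[of j] by auto
qed

lemma eval_abs_times:
  assumes "smooth_op A"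
  shows "eval (abs_sop A * P) \<psi> x c =
    (if smooth_off_origin \<psi> \<and> x \<noteq> 0 then A (rep_sop P \<psi>) x $ c else 0)"
  using rep_abs_sop[of "A \<cdot> rep_sop P" \<psi> x] assms
  by (simp add: abs_sop_hom eval_def)

lemma eval_abs:
  assumes "smooth_op A"
  shows "eval (abs_sop A) \<psi> x c = (if smooth_off_origin \<psi> \<and> x \<noteq> 0 then A \<psi> x $ c else 0)"
  using rep_abs_sop[OF assms, of \<psi> x] by (simp add: eval_def)

lemma eval_linear:
  "eval (P + Q) \<psi> x c = eval P \<psi> x c + eval Q \<psi> x c"
  "eval (P - Q) \<psi> x c = eval P \<psi> x c - eval Q \<psi> x c"
  "eval (- P) \<psi> x c = - eval P \<psi> x c"
  "eval 0 \<psi> x c = 0"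
  "eval (scal a * P) \<psi> x c = a * eval P \<psi> x c"
proof -
  show "eval (P + Q) \<psi> x c = eval P \<psi> x c + eval Q \<psi> x c"
    "eval (P - Q) \<psi> x c = eval P \<psi> x c - eval Q \<psi> x c"
    "eval (- P) \<psi> x c = - eval P \<psi> x c" "eval 0 \<psi> x c = 0"
    using eval_abs[of "rep_sop P + rep_sop Q" \<psi> x c] eval_abs[of "rep_sop P - rep_sop Q" \<psi> x c]
      eval_abs[of "- rep_sop P" \<psi> x c] eval_abs[of 0 \<psi> x c]
    by (simp_all add: abs_sop_hom op_apply eval_def)
  show "eval (scal a * P) \<psi> x c = a * eval P \<psi> x c"
    unfolding scal_def by (subst eval_abs_times) (simp_all add: op_apply eval_def)
qed

lemma scal_mult: "scal a * scal b = scal (a * b)"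
  and scal_minus: "- scal a = scal (- a)"
  and scal_1: "scal 1 = 1"
  unfolding scal_def
  by (simp_all flip: abs_sop_hom add: abs_sop_eq_iff op_eq_def op_apply vec_eq_iff algebra_simps)

lemma scal_commute: "A * scal c = scal c * A"
proof -
  have "rep_sop A \<cdot> (c *\<^sub>o id) \<doteq> (c *\<^sub>o id) \<cdot> rep_sop A"
    by (simp add: op_eq_def op_scale_def smooth_op_scale)
  then have "abs_sop (rep_sop A) * abs_sop (c *\<^sub>o id) = abs_sop (c *\<^sub>o id) * abs_sop (rep_sop A)"
    by (simp only: abs_sop_hom[symmetric] abs_sop_eq_iff smooth_op_intros smooth_op_rep_sop)
  then show ?thesis by (simp add: scal_def)
qed

lemma scal_left_commute: "A * (scal c * B) = scal c * (A * B)"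
  by (metis scal_commute mult.assoc)

section \<open>Commutation relations\<close>

text \<open>The prefix \<open>r\<close> marks the image in the ring of an operator of the statement, with
  \<open>d\<close> for partial derivatives, \<open>q\<close> for position, \<open>ir\<close> for \<open>1/r\<close> and \<open>n\<close> for \<open>x/r\<close>.\<close>

definition rs1 :: "3 \<Rightarrow> sop" where "rs1 k = abs_sop (sigma1 k)"
definition rs2 :: "3 \<Rightarrow> sop" where "rs2 k = abs_sop (sigma2 k)"
definition rq :: "3 \<Rightarrow> sop" where "rq k = abs_sop (pos k)"
definition rd :: "3 \<Rightarrow> sop" where "rd k = abs_sop (partial_deriv k)"
definition rir :: sop where "rir = abs_sop inv_r"
definition rn :: "3 \<Rightarrow> sop" where "rn k = rir * rq k"
definition rl :: "real \<Rightarrow> 3 \<Rightarrow> sop" where "rl h k = abs_sop (ang_mom h k)"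

lemma eval_sigma:
  "eval (rs1 1 * P) \<psi> x (1, j) = eval P \<psi> x (2, j)"
  "eval (rs1 1 * P) \<psi> x (2, j) = eval P \<psi> x (1, j)"
  "eval (rs1 2 * P) \<psi> x (1, j) = - \<i> * eval P \<psi> x (2, j)"
  "eval (rs1 2 * P) \<psi> x (2, j) = \<i> * eval P \<psi> x (1, j)"
  "eval (rs1 3 * P) \<psi> x (1, j) = eval P \<psi> x (1, j)"
  "eval (rs1 3 * P) \<psi> x (2, j) = - eval P \<psi> x (2, j)"
  "eval (rs2 1 * P) \<psi> x (j, 1) = eval P \<psi> x (j, 2)"
  "eval (rs2 1 * P) \<psi> x (j, 2) = eval P \<psi> x (j, 1)"
  "eval (rs2 2 * P) \<psi> x (j, 1) = - \<i> * eval P \<psi> x (j, 2)"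
  "eval (rs2 2 * P) \<psi> x (j, 2) = \<i> * eval P \<psi> x (j, 1)"
  "eval (rs2 3 * P) \<psi> x (j, 1) = eval P \<psi> x (j, 1)"
  "eval (rs2 3 * P) \<psi> x (j, 2) = - eval P \<psi> x (j, 2)"
proof -
  have *: "(UNIV :: (2 \<times> 2) set) = {(1,1),(1,2),(2,1),(2,2)}"
    using UNIV_2 by (auto simp flip: UNIV_Times_UNIV)
  show "eval (rs1 1 * P) \<psi> x (1, j) = eval P \<psi> x (2, j)"
  "eval (rs1 1 * P) \<psi> x (2, j) = eval P \<psi> x (1, j)"
  "eval (rs1 2 * P) \<psi> x (1, j) = - \<i> * eval P \<psi> x (2, j)"
  "eval (rs1 2 * P) \<psi> x (2, j) = \<i> * eval P \<psi> x (1, j)"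
  "eval (rs1 3 * P) \<psi> x (1, j) = eval P \<psi> x (1, j)"
  "eval (rs1 3 * P) \<psi> x (2, j) = - eval P \<psi> x (2, j)"
  "eval (rs2 1 * P) \<psi> x (j, 1) = eval P \<psi> x (j, 2)"
  "eval (rs2 1 * P) \<psi> x (j, 2) = eval P \<psi> x (j, 1)"
  "eval (rs2 2 * P) \<psi> x (j, 1) = - \<i> * eval P \<psi> x (j, 2)"
  "eval (rs2 2 * P) \<psi> x (j, 2) = \<i> * eval P \<psi> x (j, 1)"
  "eval (rs2 3 * P) \<psi> x (j, 1) = eval P \<psi> x (j, 1)"
  "eval (rs2 3 * P) \<psi> x (j, 2) = - eval P \<psi> x (j, 2)"
    using exhaust_2[of j] unfolding rs1_def rs2_def
    by (subst eval_abs_times, simp, force simp: eval_def sigma1_def sigma2_def kronecker_def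
      pauli_def matrix_vector_mult_def * mat_def)+
qed

lemma eval_coord:
  "eval (rir * P) \<psi> x c = of_real (1 / norm x) * eval P \<psi> x c"
  "eval (rq k * P) \<psi> x c = of_real (x $ k) * eval P \<psi> x c"
  unfolding rir_def rq_def
  by (subst eval_abs_times, simp, simp add: eval_def radial_def pos_def)+

text \<open>The evaluation rules act on the leftmost factor of a product; these instances cover the
  last factor, which has nothing to its right.\<close>

lemmas eval_left_1 = eval_sigma[where P = 1, simplified mult_1_right]
  eval_coord[where P = 1, simplified mult_1_right] eval_linear(5)[where P = 1, simplified mult_1_right]

lemma sigma_commute:
  "rs2 j * rs1 k = rs1 k * rs2 j" "rq j * rs1 k = rs1 k * rq j" "rq j * rs2 k = rs2 k * rq j"
  "rir * rs1 k = rs1 k * rir" "rir * rs2 k = rs2 k * rir"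
  using exhaust_3[of j] exhaust_3[of k]
  by (auto intro!: sop_eqI_components simp: eval_sigma eval_coord eval_left_1)

lemma coord_commute: "rq j * rq k = rq k * rq j" "rir * rq k = rq k * rir"
  by (auto intro!: sop_eqI simp: eval_coord eval_left_1)

lemma d_sigma_commute: "rd j * rs1 k = rs1 k * rd j" "rd j * rs2 k = rs2 k * rd j"
proof -
  have "partial_deriv j \<cdot> sigma1 k \<doteq> sigma1 k \<cdot> partial_deriv j"
    "partial_deriv j \<cdot> sigma2 k \<doteq> sigma2 k \<cdot> partial_deriv j"
    by (simp_all add: op_eq_def sigma1_def[abs_def] sigma2_def[abs_def]
      partial_deriv_linear_image[OF bounded_linear_matrix] smooth_imp_differentiable)
  then show "rd j * rs1 k = rs1 k * rd j" "rd j * rs2 k = rs2 k * rd j"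
    unfolding rd_def rs1_def rs2_def by (simp_all flip: abs_sop_hom add: abs_sop_eq_iff)
qed

lemma d_commute: "rd j * rd k = rd k * rd j"
  unfolding rd_def by (simp flip: abs_sop_hom add: abs_sop_eq_iff op_eq_def partial_deriv_commute)

lemma d_q: "rd j * rq k = rq k * rd j + (if j = k then 1 else 0)"
proof -
  have "(partial_deriv j \<cdot> pos k) \<psi> x = (pos k \<cdot> partial_deriv j + (if j = k then id else 0)) \<psi> x"
    if "smooth_off_origin \<psi>" "x \<noteq> 0" for \<psi> x
  proof -
    have "((\<lambda>y. y $ k) has_derivative (\<lambda>h. h $ k)) (at x)"
      by (rule bounded_linear_imp_has_derivative[OF bounded_linear_vec_nth])
    from partial_deriv_scaleR[OF this smooth_imp_differentiable[OF that], of j] show ?thesis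
      by (auto simp: pos_def[abs_def] scaleR_eq_vector_scale axis_def op_apply)
  qed
  then have "partial_deriv j \<cdot> pos k \<doteq> pos k \<cdot> partial_deriv j + (if j = k then id else 0)"
    by (simp add: op_eq_def)
  then show ?thesis
    unfolding rd_def rq_def by (simp flip: abs_sop_hom add: abs_sop_eq_iff split: if_splits)
qed

lemma d_ir: "rd j * rir = rir * rd j - rq j * (rir * (rir * rir))"
proof -
  have "(partial_deriv j \<cdot> inv_r) \<psi> x =
      (inv_r \<cdot> partial_deriv j - pos j \<cdot> (inv_r \<cdot> (inv_r \<cdot> inv_r))) \<psi> x"
    if "smooth_off_origin \<psi>" "x \<noteq> 0" for \<psi> x
    using partial_deriv_scaleR[OF has_derivative_inverse_norm[OF that(2)] smooth_imp_differentiable[OF that], of j]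
    by (simp add: radial_def[abs_def] pos_def scaleR_eq_vector_scale inner_axis op_apply
        vec_eq_iff power3_eq_cube)
  then have "partial_deriv j \<cdot> inv_r \<doteq> inv_r \<cdot> partial_deriv j - pos j \<cdot> (inv_r \<cdot> (inv_r \<cdot> inv_r))"
    by (simp add: op_eq_def)
  then show ?thesis
    unfolding rd_def rq_def rir_def by (simp flip: abs_sop_hom add: abs_sop_eq_iff)
qed

text \<open>In right-associated products two neighbours appear as \<open>A * (B * P)\<close>. This
  turns a rule for \<open>A * B\<close> into one that also applies inside a longer product.\<close>

lemma reassoc: "A * B = C \<Longrightarrow> A * (B * P) = C * (P :: sop)"
  by (metis mult.assoc)

section \<open>Orbital angular momentum in the ring\<close>

lemma l_eq: "rl h k = scal (- \<i> * h) * (rq (k + 1) * rd (k + 2) - rq (k + 2) * rd (k + 1))"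
  unfolding rl_def ang_mom_def
  by (simp add: abs_sop_cross mom_def abs_sop_scale rq_def rd_def scal_left_commute right_diff_distrib)

lemmas scal_move =
  scal_commute[of "rs1 k" for k] scal_commute[of "rs2 k" for k] scal_commute[of "rq k" for k]
  scal_commute[of "rd k" for k] scal_commute[of rir] scal_commute[of "rl h k" for h k]
  scal_left_commute[of "rs1 k" for k] scal_left_commute[of "rs2 k" for k] scal_left_commute[of "rq k" for k]
  scal_left_commute[of "rd k" for k] scal_left_commute[of rir] scal_left_commute[of "rl h k" for h k]
  scal_mult scal_mult[THEN reassoc]

lemmas ring_distribs_assoc = distrib_left distrib_right left_diff_distrib right_diff_distrib mult.assoc
  mult_minus_left mult_minus_right

lemma l_sigma: "rl h j * rs1 k = rs1 k * rl h j" "rl h j * rs2 k = rs2 k * rl h j"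
  by (simp_all add: l_eq ring_distribs_assoc d_sigma_commute sigma_commute
      sigma_commute[THEN reassoc] scal_move)

text \<open>\<open>L\<close> differentiates along spheres: the terms from differentiating
  \<open>1/r\<close> are \<open>x_j x_k - x_k x_j\<close> over \<open>r^3\<close> and
  cancel.\<close>

lemma l_ir: "rl h j * rir = rir * rl h j"
  by (auto intro!: sop_eqI simp: l_eq ring_distribs_assoc d_ir scal_move
      eval_linear eval_coord eval_left_1 algebra_simps)

lemma l_q:
  "rl h k * rq k = rq k * rl h k"
  "rl h k * rq (k + 1) = rq (k + 1) * rl h k + scal (\<i> * h) * rq (k + 2)"
  "rl h k * rq (k + 2) = rq (k + 2) * rl h k - scal (\<i> * h) * rq (k + 1)"
  using exhaust_3[of k]
  by (auto intro!: sop_eqI simp: numeral_3_simps l_eq ring_distribs_assoc d_q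
      scal_move eval_linear eval_coord eval_left_1 algebra_simps)

lemma l_l: "rl h k * rl h (k + 1) = rl h (k + 1) * rl h k + scal (\<i> * h) * rl h (k + 2)"
  using exhaust_3[of k]
  by (auto intro!: sop_eqI simp: numeral_3_simps l_eq ring_distribs_assoc d_q d_q[THEN reassoc]
      d_commute[of 2 1] d_commute[of 3 1] d_commute[of 3 2] 
      scal_move eval_linear eval_coord eval_left_1 algebra_simps)

lemma l_n:
  "rl h k * rn k = rn k * rl h k"
  "rl h k * rn (k + 1) = rn (k + 1) * rl h k + scal (\<i> * h) * rn (k + 2)"
  "rl h k * rn (k + 2) = rn (k + 2) * rl h k - scal (\<i> * h) * rn (k + 1)"
  by (simp_all add: rn_def ring_distribs_assoc l_ir[THEN reassoc] l_q scal_move)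

lemma n_l: "rn 1 * rl h 1 + rn 2 * rl h 2 + rn 3 * rl h 3 = 0"
  by (auto intro!: sop_eqI simp: rn_def l_eq numeral_3_simps ring_distribs_assoc scal_move
      eval_linear eval_coord eval_left_1 algebra_simps)

definition nv :: "real^3 \<Rightarrow> 3 \<Rightarrow> complex" where "nv x k = of_real (x $ k / norm x)"

lemma eval_n: "eval (rn k * P) \<psi> x c = nv x k * eval P \<psi> x c"
  by (simp add: rn_def mult.assoc eval_coord nv_def)

lemma nv_sq:
  assumes "x \<noteq> 0"
  shows "nv x 1 * nv x 1 + nv x 2 * nv x 2 + nv x 3 * nv x 3 = 1"
proof -
  have "(x $ 1 / norm x) * (x $ 1 / norm x) + (x $ 2 / norm x) * (x $ 2 / norm x)
      + (x $ 3 / norm x) * (x $ 3 / norm x) = (norm x)\<^sup>2 / (norm x)\<^sup>2"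
    by (subst (1) norm_sq_3) (simp add: power2_eq_square add_divide_distrib)
  also have "\<dots> = 1" using assms by simp
  finally have "(x $ 1 / norm x) * (x $ 1 / norm x) + (x $ 2 / norm x) * (x $ 2 / norm x)
      + (x $ 3 / norm x) * (x $ 3 / norm x) = 1" .
  then show ?thesis
    unfolding nv_def by (simp only: of_real_add[symmetric] of_real_mult[symmetric]) simp
qed

lemma n_sum_sq: "rn 1 * rn 1 + rn 2 * rn 2 + rn 3 * rn 3 = 1"
proof (rule sop_eqI)
  fix \<psi> x i k assume "smooth_off_origin \<psi>" and x: "(x::real^3) \<noteq> 0"
  have "eval (rn 1 * rn 1 + rn 2 * rn 2 + rn 3 * rn 3) \<psi> x (i, k)
      = (nv x 1 * nv x 1 + nv x 2 * nv x 2 + nv x 3 * nv x 3) * eval 1 \<psi> x (i, k)"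
    by (simp add: eval_linear eval_n eval_n[where P = 1, simplified mult_1_right] algebra_simps)
  then show "eval (rn 1 * rn 1 + rn 2 * rn 2 + rn 3 * rn 3) \<psi> x (i, k) = eval 1 \<psi> x (i, k)"
    by (simp add: nv_sq[OF x])
qed

text \<open>\<open>rN\<close>, \<open>rA\<close>, \<open>rB\<close> are \<open>Y\<^sub>P\<^sup>5\<close>, \<open>Y\<^sub>P\<^sup>6\<close>, \<open>Y\<^sub>P\<^sup>6 + Y\<^sub>P\<^sup>7\<close>.\<close>

definition rK where "rK = rs1 1 * rs2 1 + rs1 2 * rs2 2 + rs1 3 * rs2 3"
definition rN where "rN =
  rn 1 * (rs1 2 * rs2 3 - rs1 3 * rs2 2) + rn 2 * (rs1 3 * rs2 1 - rs1 1 * rs2 3)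
  + rn 3 * (rs1 1 * rs2 2 - rs1 2 * rs2 1)"
definition rA where "rA = rs1 1 * rn 1 + rs1 2 * rn 2 + rs1 3 * rn 3"
definition rB where "rB = rs2 1 * rn 1 + rs2 2 * rn 2 + rs2 3 * rn 3"
definition rX where "rX h = rs2 1 * rl h 1 + rs2 2 * rl h 2 + rs2 3 * rl h 3"
definition rY where "rY h = rs1 1 * rl h 1 + rs1 2 * rl h 2 + rs1 3 * rl h 3"
definition rZ where "rZ h =
  (rs1 2 * rs2 3 - rs1 3 * rs2 2) * rl h 1 + (rs1 3 * rs2 1 - rs1 1 * rs2 3) * rl h 2
  + (rs1 1 * rs2 2 - rs1 2 * rs2 1) * rl h 3"
definition rL2 where "rL2 h = rl h 1 * rl h 1 + rl h 2 * rl h 2 + rl h 3 * rl h 3"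

lemmas op_defs = rK_def rN_def rA_def rB_def rX_def rY_def rZ_def rL2_def

lemma l_n_123:
  "rl h 1 * rn 1 = rn 1 * rl h 1" "rl h 1 * rn 2 = rn 2 * rl h 1 + scal (\<i> * h) * rn 3" "rl h 1 * rn 3 = rn 3 * rl h 1 - scal (\<i> * h) * rn 2"
  "rl h 2 * rn 2 = rn 2 * rl h 2" "rl h 2 * rn 3 = rn 3 * rl h 2 + scal (\<i> * h) * rn 1" "rl h 2 * rn 1 = rn 1 * rl h 2 - scal (\<i> * h) * rn 3"
  "rl h 3 * rn 3 = rn 3 * rl h 3" "rl h 3 * rn 1 = rn 1 * rl h 3 + scal (\<i> * h) * rn 2" "rl h 3 * rn 2 = rn 2 * rl h 3 - scal (\<i> * h) * rn 1"
  using l_n[of h 1] l_n[of h 2] l_n[of h 3] by (simp_all add: numeral_3_simps)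

text \<open>Oriented as rewrite rules that sort the \<open>L\<close>'s by index. Together with
  \<open>l_sigma\<close> and \<open>l_n_123\<close> they move each \<open>L\<close> to the right end
  of a product. Pauli matrices and \<open>n\<close> are then evaluated from the left in whatever
  order they stand, and what remains are coefficients of sorted \<open>L\<close>-monomials applied
  to the field.\<close>

lemma l_l_123:
  "rl h 2 * rl h 1 = rl h 1 * rl h 2 - scal (\<i> * h) * rl h 3"
  "rl h 3 * rl h 2 = rl h 2 * rl h 3 - scal (\<i> * h) * rl h 1"
  "rl h 3 * rl h 1 = rl h 1 * rl h 3 + scal (\<i> * h) * rl h 2"
  using l_l[of h 1] l_l[of h 2] l_l[of h 3] by (simp_all add: numeral_3_simps)

lemmas scal_n = scal_commute[of "rn k" for k] scal_left_commute[of "rn k" for k]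
lemmas move_right = ring_distribs_assoc l_sigma l_sigma[THEN reassoc] l_n_123 l_n_123[THEN reassoc]
  l_l_123 l_l_123[THEN reassoc] scal_move scal_n
lemmas eval_all = eval_linear eval_sigma eval_n eval_left_1 eval_n[where P = 1, simplified mult_1_right]


text \<open>The terms \<open>(n, n)\<close> and \<open>(n, L)\<close> on the right-hand sides below make the identities hold without
  using \<open>(n, n) = 1\<close> and \<open>(n, L) = 0\<close>, so that comparing coefficients suffices.\<close>

lemma matrix_relations:
  "rK * rA - rA * rK = scal (2 * \<i>) * rN"
  "rK * rB - rB * rK = scal (- 2 * \<i>) * rN"
  "rK * rN - rN * rK = scal (4 * \<i>) * (rB - rA)"
  "rA * rB = rB * rA"
  by (rule sop_eqI_components; simp add: op_defs move_right eval_all algebra_simps)+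

text \<open>Since \<open>N = (sigma_1, sigma_2 x n)\<close>, the Pauli commutator gives
  \<open>[A, N] = 2i (sigma_1, n x (sigma_2 x n))\<close>, and the double cross product expands to
  \<open>K (n, n) - A B\<close>. Exchanging the spins gives the opposite sign for
  \<open>B\<close>.\<close>

lemma A_N: "rA * rN - rN * rA = scal (2 * \<i>) * (rK * (rn 1 * rn 1 + rn 2 * rn 2 + rn 3 * rn 3) - rA * rB)"
  and B_N: "rB * rN - rN * rB = scal (- 2 * \<i>) * (rK * (rn 1 * rn 1 + rn 2 * rn 2 + rn 3 * rn 3) - rA * rB)"
  and N_N: "rN * rN = scal 2 * (rn 1 * rn 1 + rn 2 * rn 2 + rn 3 * rn 3 - rA * rB)"
  by (rule sop_eqI_components; simp add: op_defs move_right eval_all algebra_simps)+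

text \<open>\<open>K = 2 P - 1\<close>, where \<open>P\<close> exchanges the two spins and
  \<open>P Y = X P\<close>. Hence \<open>K\<close> commutes with \<open>X + Y\<close>, and the
  double commutator of \<open>K\<close> with \<open>Y\<close> is \<open>8 (Y - X)\<close>.\<close>

lemma K_orbital:
  "rK * rY h - rY h * rK = scal (2 * \<i>) * rZ h"
  "rK * rX h - rX h * rK = scal (- 2 * \<i>) * rZ h"
  "rK * rZ h - rZ h * rK = scal (4 * \<i>) * (rX h - rY h)"
  by (rule sop_eqI_components; simp add: op_defs move_right eval_all algebra_simps)+

text \<open>By \<open>(sigma, a)(sigma, b) = (a, b) + i (sigma, a x b)\<close> and
  \<open>L x n + n x L = 2 i h n\<close>, the anticommutator of \<open>Y\<close> and
  \<open>A\<close> is \<open>2 (n, L) - 2 h A\<close>: up to \<open>(n, L)\<close>, \<open>A\<close>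
  anticommutes with \<open>Y + h\<close>. In the mixed cases the two spins commute and only
  \<open>[L_j, n_k]\<close> contributes, which produces \<open>N\<close>.\<close>

lemma orbital_matrix:
  "rY h * rA - rA * rY h = scal (- 2) * (rA * rY h) + scal (- 2 * h) * rA
    + scal 2 * (rn 1 * rl h 1 + rn 2 * rl h 2 + rn 3 * rl h 3)"
  "rX h * rB - rB * rX h = scal (- 2) * (rB * rX h) + scal (- 2 * h) * rB
    + scal 2 * (rn 1 * rl h 1 + rn 2 * rl h 2 + rn 3 * rl h 3)"
  "rX h * rA - rA * rX h = scal (- \<i> * h) * rN"
  "rY h * rB - rB * rY h = scal (\<i> * h) * rN"
  by (rule sop_eqI_components; simp add: op_defs move_right eval_all algebra_simps)+

lemma orbital_N_aux:
  "rY h * rN - rN * rY h = scal (- 2 * \<i>) * (rA * rX h) + scal (- h) * rN + scal (- 2 * \<i> * h) * rB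
    + scal (2 * \<i>) * (rK * (rn 1 * rl h 1 + rn 2 * rl h 2 + rn 3 * rl h 3))"
  "rX h * rN - rN * rX h = scal (2 * \<i>) * (rB * rY h) + scal (- h) * rN + scal (2 * \<i> * h) * rA
    + scal (- 2 * \<i>) * (rK * (rn 1 * rl h 1 + rn 2 * rl h 2 + rn 3 * rl h 3))"
  by (rule sop_eqI_components; simp add: op_defs move_right eval_all algebra_simps)+

text \<open>These commutators are absent from the displayed relations but are required for closure.
  On the right each product already has the matrix generator to the left of \<open>X\<close>,
  \<open>Y\<close> or \<open>Z\<close>, as the ordered monomials demand.\<close>

lemma Z_matrix_aux:
  "rZ h * rA - rA * rZ h = scal (- 2) * (rN * rY h) + scal (- 2) * (rA * rZ h) + scal (2 * \<i>) * (rA * rX h)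
    + scal (- h) * rN + scal (2 * \<i> * h) * rB
    + scal (- 2 * \<i>) * (rK * (rn 1 * rl h 1 + rn 2 * rl h 2 + rn 3 * rl h 3))"
  "rZ h * rB - rB * rZ h = scal (- 2) * (rN * rX h) + scal (- 2) * (rB * rZ h) + scal (- 2 * \<i>) * (rB * rY h)
    + scal (- h) * rN + scal (- 2 * \<i> * h) * rA
    + scal (2 * \<i>) * (rK * (rn 1 * rl h 1 + rn 2 * rl h 2 + rn 3 * rl h 3))"
  "rZ h * rN - rN * rZ h = scal (- 2 * \<i>) * (rN * rX h) + scal (2 * \<i>) * (rA * rZ h)
    + scal (- 4) * (rA * rY h) + scal (- 2 * h) * (rA + rB)
    + scal 4 * (rn 1 * rl h 1 + rn 2 * rl h 2 + rn 3 * rl h 3)"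
  by (rule sop_eqI_components; simp add: op_defs move_right eval_all algebra_simps)+

text \<open>The last two right-hand sides are opposite up to the terms linear in \<open>X\<close>
  and \<open>Y\<close>: \<open>h (X + Y)\<close> is \<open>J^2 - L^2 - (h^2/4)(6 + 2 K)\<close>, and
  as \<open>J^2\<close> and \<open>L^2\<close> commute with \<open>Z\<close>, only
  \<open>[K, Z]\<close> contributes to the commutator of \<open>X + Y\<close> with
  \<open>Z\<close>.\<close>

lemma orbital_orbital:
  "rY h * rX h - rX h * rY h = scal (\<i> * h) * rZ h"
  "rY h * rZ h - rZ h * rY h = scal (2 * \<i>) * (rK * rL2 h) - scal \<i> * (rY h * rX h + rX h * rY h) - scal (2 * \<i> * h) * rX h"
  "rX h * rZ h - rZ h * rX h = scal (- 2 * \<i>) * (rK * rL2 h) + scal \<i> * (rY h * rX h + rX h * rY h) + scal (2 * \<i> * h) * rY h"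
  by (rule sop_eqI_components; simp add: op_defs move_right eval_all algebra_simps)+

section \<open>Total angular momentum\<close>

definition rj :: "real \<Rightarrow> 3 \<Rightarrow> sop" where "rj h k = rl h k + scal (h / 2) * (rs1 k + rs2 k)"
definition rJ2 where "rJ2 h = rj h 1 * rj h 1 + rj h 2 * rj h 2 + rj h 3 * rj h 3"

text \<open>\<open>L\<close> commutes with the spins, so the cross term of \<open>J^2\<close> is
  \<open>h (X + Y)\<close>; the spin part is \<open>h^2/4\<close> times
  \<open>(sigma_1 + sigma_2)^2 = 6 + 2 K\<close>.\<close>

lemma J2_eq: "rL2 h = rJ2 h - scal h * (rX h + rY h) - scal (h\<^sup>2 / 4) * (scal 6 + scal 2 * rK)"
  by (rule sop_eqI_components)
    (simp add: rJ2_def rj_def op_defs move_right eval_all algebra_simps power2_eq_square)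

lemma j_j:
  "rj h 1 * rj h 2 - rj h 2 * rj h 1 = scal (\<i> * h) * rj h 3"
  "rj h 2 * rj h 3 - rj h 3 * rj h 2 = scal (\<i> * h) * rj h 1"
  "rj h 3 * rj h 1 - rj h 1 * rj h 3 = scal (\<i> * h) * rj h 2"
  by (rule sop_eqI_components; simp add: rj_def op_defs move_right eval_all algebra_simps)+

text \<open>Under \<open>J\<close> the spins, \<open>n\<close> and \<open>L\<close> all rotate as
  vectors, and the operators here and in \<open>j_orbital\<close> are scalar or triple products of
  them.\<close>

lemma j_scalar:
  "rj h k * rK = rK * rj h k" "rj h k * rN = rN * rj h k" "rj h k * rA = rA * rj h k" "rj h k * rB = rB * rj h k"
  using exhaust_3[of k]
  by (auto intro!: sop_eqI_components simp: rj_def op_defs move_right eval_all algebra_simps)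

lemma j_orbital:
  "rj h k * rX h = rX h * rj h k" "rj h k * rY h = rY h * rj h k" "rj h k * rZ h = rZ h * rj h k"
  using exhaust_3[of k]
  by (auto intro!: sop_eqI_components simp: rj_def op_defs move_right eval_all algebra_simps)


lemma l_123:
  "rl h 1 = scal (- \<i> * h) * (rq 2 * rd 3 - rq 3 * rd 2)"
  "rl h 2 = scal (- \<i> * h) * (rq 3 * rd 1 - rq 1 * rd 3)"
  "rl h 3 = scal (- \<i> * h) * (rq 1 * rd 2 - rq 2 * rd 1)"
  using l_eq[of h 1] l_eq[of h 2] l_eq[of h 3] by (simp_all only: numeral_3_simps)

section \<open>Conservation\<close>

definition rE where "rE = rq 1 * rd 1 + rq 2 * rd 2 + rq 3 * rd 3"

lemma ir_q: "rir * (rir * (rq 1 * rq 1 + rq 2 * rq 2 + rq 3 * rq 3)) = 1"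
proof -
  have "rir * (rir * (rq 1 * rq 1 + rq 2 * rq 2 + rq 3 * rq 3)) = rn 1 * rn 1 + rn 2 * rn 2 + rn 3 * rn 3"
    by (auto intro!: sop_eqI simp: rn_def mult.assoc ring_distribs_assoc eval_linear eval_coord eval_left_1 algebra_simps)
  then show ?thesis by (simp add: n_sum_sq)
qed

lemmas d_order = d_commute[of 2 1] d_commute[of 3 1] d_commute[of 3 2]

text \<open>Commutation with \<open>E\<close> measures the degree of homogeneity: 1 for
  \<open>x_k\<close>, -1 for \<open>1/r\<close>, and hence 0 for \<open>n\<close> and
  \<open>L\<close>.\<close>

lemma euler_q: "rE * rq k = rq k * rE + rq k"
  using exhaust_3[of k]
  by (auto intro!: sop_eqI simp: rE_def ring_distribs_assoc d_q eval_linear eval_coord eval_left_1 algebra_simps)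

lemma euler_ir: "rE * rir = rir * rE - rir"
proof -
  have "rE * rir = rir * rE - rir * (rir * (rir * (rq 1 * rq 1 + rq 2 * rq 2 + rq 3 * rq 3)))"
    by (auto intro!: sop_eqI simp: rE_def ring_distribs_assoc d_ir eval_linear eval_coord eval_left_1 algebra_simps)
  then show ?thesis by (simp add: ir_q)
qed

lemma euler_sigma: "rE * rs1 k = rs1 k * rE" "rE * rs2 k = rs2 k * rE"
  by (simp_all add: rE_def ring_distribs_assoc d_sigma_commute sigma_commute sigma_commute[THEN reassoc])

lemma euler_n: "rE * rn k = rn k * rE"
  by (simp add: rn_def euler_ir[THEN reassoc] left_diff_distrib mult.assoc euler_q distrib_left)

lemma euler_l: "rE * rl h k = rl h k * rE"
  using exhaust_3[of k]
  by (auto intro!: sop_eqI simp: rE_def l_123 ring_distribs_assoc d_q d_q[THEN reassoc] d_order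
      scal_move eval_linear eval_coord eval_left_1 algebra_simps)

text \<open>The splitting of the Laplacian into radial and angular part, multiplied by
  \<open>h^2 r^2\<close>. Free of denominators, it is an identity between polynomials in coordinates
  and derivatives, checked by moving the derivatives to the right.\<close>

lemma laplace_aux:
  "scal (h\<^sup>2) * ((rq 1 * rq 1 + rq 2 * rq 2 + rq 3 * rq 3) * (rd 1 * rd 1 + rd 2 * rd 2 + rd 3 * rd 3))
    = scal (h\<^sup>2) * (rE * rE + rE) - rL2 h"
  by (auto intro!: sop_eqI simp: rE_def rL2_def l_123 ring_distribs_assoc d_q d_q[THEN reassoc] d_order
      scal_move eval_linear eval_coord eval_left_1 algebra_simps power2_eq_square)

definition rr where "rr = abs_sop (radial (\<lambda>r. r))"

lemma smooth_op_norm [simp]: "smooth_op (radial (\<lambda>r. r))"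
  using smooth_op_linear_radial[of 0 1] by simp

lemma eval_rr: "eval (rr * P) \<psi> x c = of_real (norm x) * eval P \<psi> x c"
  unfolding rr_def by (subst eval_abs_times, simp, simp add: eval_def radial_def)

lemma rr_ir: "rr * rir = 1" "rir * rr = 1"
  by (auto intro!: sop_eqI simp: eval_rr eval_coord eval_left_1 eval_rr[where P = 1, simplified mult_1_right])

lemma rr_eq: "rr = rir * (rq 1 * rq 1 + rq 2 * rq 2 + rq 3 * rq 3)"
  by (metis ir_q mult.assoc mult_1_left mult_1_right rr_ir(1))

section \<open>Images of the given operators in the ring\<close>

lemma smooth_op_generators [simp]:
  "smooth_op K_op" "smooth_op YP5" "smooth_op YP6" "smooth_op YP7"
  "smooth_op (X_op h)" "smooth_op (Y_op h)" "smooth_op (Z_op h)"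
  "smooth_op (L_sq h)" "smooth_op (J_sq h)" "smooth_op laplacian"
  "smooth_op (YP1 h)" "smooth_op (YP2 h)" "smooth_op (YP3 h)" "smooth_op (YP4 h)"
  "smooth_op (Ham h (\<lambda>r. a + b * r))"
  unfolding K_op_def YP5_def YP6_def YP7_def X_op_def Y_op_def Z_op_def L_sq_def J_sq_def
    YP1_def YP2_def YP3_def YP4_def Ham_def laplacian_def
  by (intro smooth_op_intros smooth_op_norm smooth_op_sum_3)+

lemma abs_basic:
  "abs_sop (sigma1 k) = rs1 k" "abs_sop (sigma2 k) = rs2 k" "abs_sop (pos k) = rq k"
  "abs_sop (partial_deriv k) = rd k" "abs_sop inv_r = rir" "abs_sop (ang_mom h k) = rl h k"
  "abs_sop (radial (\<lambda>r. r)) = rr" "abs_sop (mom h k) = scal (- \<i> * h) * rd k"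
  by (simp_all add: rs1_def rs2_def rq_def rd_def rir_def rl_def rr_def mom_def abs_sop_scale)

lemma abs_generators:
  "abs_sop K_op = rK" "abs_sop YP5 = rN" "abs_sop YP6 = rA" "abs_sop YP7 = rB - rA"
  "abs_sop (X_op h) = rX h" "abs_sop (Y_op h) = rY h" "abs_sop (Z_op h) = rZ h"
  "abs_sop (tot_ang_mom h k) = rj h k" "abs_sop (L_sq h) = rL2 h" "abs_sop (J_sq h) = rJ2 h"
proof -
  have n: "rir * (P * rq k) = P * rn k" if "rir * P = P * rir" for k P
    using that by (simp add: rn_def flip: mult.assoc)
  have n': "rir * (rq k * P) = rn k * P" for k P
    by (simp add: rn_def mult.assoc)
  show *: "abs_sop (tot_ang_mom h k) = rj h k" for h k
    by (simp add: tot_ang_mom_def rj_def abs_sop_hom abs_sop_scale abs_basic)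
  show "abs_sop K_op = rK" "abs_sop YP5 = rN" "abs_sop YP6 = rA" "abs_sop YP7 = rB - rA"
    "abs_sop (X_op h) = rX h" "abs_sop (Y_op h) = rY h" "abs_sop (Z_op h) = rZ h"
    "abs_sop (L_sq h) = rL2 h" "abs_sop (J_sq h) = rJ2 h"
    by (simp_all add: K_op_def YP5_def YP6_def YP7_def X_op_def Y_op_def Z_op_def L_sq_def J_sq_def
        abs_sop_inner abs_sop_cross abs_sop_hom abs_basic numeral_3_simps rK_def rA_def rB_def rN_def
        rX_def rY_def rZ_def rL2_def rJ2_def * ring_distribs_assoc n n' sigma_commute algebra_simps)
qed

lemma inv_sq_radial: "abs_sop (radial (\<lambda>r. c / (e * r\<^sup>2))) = scal (c / e) * (rir * rir)"
  by (rule sop_eqI, subst eval_abs, simp)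
    (simp add: eval_linear eval_coord eval_left_1 radial_def power2_eq_square,
     simp add: eval_def rep_abs_sop one_sop_def op_eq_def)

lemma linear_radial: "abs_sop (radial (\<lambda>r. a + b * r)) = scal a + scal b * rr"
  by (rule sop_eqI, subst eval_abs, simp)
    (simp add: eval_linear eval_coord eval_rr eval_left_1 radial_def
      eval_rr[where P = 1, simplified mult_1_right],
     simp add: eval_def rep_abs_sop one_sop_def op_eq_def algebra_simps)

text \<open>For \<open>YP2\<close> and \<open>YP3\<close>,
  \<open>(sigma, n)(sigma, L) = (n, L) + i (sigma, n x L)\<close> with \<open>(n, L) = 0\<close>,
  and \<open>n x (x x p)\<close> is \<open>(1/r) x (x, p) - r p\<close>. This accounts for the two
  terms with momenta; the last term of each definition is the \<open>h\<close> in
  \<open>X + h\<close> or \<open>Y + h\<close>.\<close>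

lemma abs_YP:
  "abs_sop (YP1 h) = - (rA * rX h) + scal (\<i> * h / 2) * rN"
  "abs_sop (YP4 h) = rA * rX h - rB * rY h - scal (\<i> * h) * rN"
  "abs_sop (YP2 h) = scal (- \<i>) * (rB * (rX h + scal h))"
  "abs_sop (YP3 h) = scal \<i> * (rA * (rY h + scal h))"
proof -
  have a: "rir * abs_sop (op_inner sigma1 pos) = rA" "rir * abs_sop (op_inner sigma2 pos) = rB"
    "rir * abs_sop (op_inner pos sigma_cross) = rN"
    using abs_generators(3,4,2) unfolding YP6_def YP7_def YP5_def
    by (simp_all add: abs_sop_hom abs_basic abs_sop_inner abs_sop_cross algebra_simps numeral_3_simps)
  have b: "abs_sop (op_inner sigma1 (ang_mom h)) = rY h" "abs_sop (op_inner sigma2 (ang_mom h)) = rX h"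
    using abs_generators(5,6) by (simp_all add: X_op_def Y_op_def)
  show "abs_sop (YP1 h) = - (rA * rX h) + scal (\<i> * h / 2) * rN"
    by (simp add: YP1_def abs_sop_hom abs_basic abs_sop_scale a b)
  show "abs_sop (YP4 h) = rA * rX h - rB * rY h - scal (\<i> * h) * rN"
    by (simp add: YP4_def abs_sop_hom abs_basic abs_sop_scale b distrib_left right_diff_distrib
        a scal_left_commute flip: mult.assoc) (simp add: a mult.assoc scal_left_commute)
  show "abs_sop (YP2 h) = scal (- \<i>) * (rB * (rX h + scal h))"
    \<comment> \<open>On the right the factor \<open>r\<close> arises as \<open>(x, x) / r\<close>;
      \<open>rr_eq\<close> brings the \<open>r\<close> of the definition to that form.\<close>
    by (rule sop_eqI_components)
      (simp add: YP2_def abs_sop_hom abs_sop_scale abs_sop_inner abs_basic rr_eq rB_def rX_def rn_def l_123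
        ring_distribs_assoc scal_move eval_linear eval_sigma eval_coord eval_left_1 algebra_simps)
  show "abs_sop (YP3 h) = scal \<i> * (rA * (rY h + scal h))"
    by (rule sop_eqI_components)
      (simp add: YP3_def abs_sop_hom abs_sop_scale abs_sop_inner abs_basic rr_eq rA_def rY_def rn_def l_123
        ring_distribs_assoc scal_move eval_linear eval_sigma eval_coord eval_left_1 algebra_simps)
qed

lemma abs_Ham_linear:
  "abs_sop (Ham h (\<lambda>r. a + b * r)) =
    scal (- (h\<^sup>2 / 2)) * (rd 1 * rd 1 + rd 2 * rd 2 + rd 3 * rd 3) + (scal a + scal b * rr)
    + scal (h / 2) * (rir * rir) * (rX h + rY h) + scal (h\<^sup>2 / 4) * (rir * rir) * rK"
proof -
  have "abs_sop (op_inner (\<lambda>k. sigma1 k + sigma2 k) (ang_mom h)) = rX h + rY h"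
    by (simp add: abs_sop_inner abs_sop_hom abs_basic rX_def rY_def algebra_simps)
  moreover have "abs_sop laplacian = rd 1 * rd 1 + rd 2 * rd 2 + rd 3 * rd 3"
    by (simp add: laplacian_def sum_3 abs_sop_hom abs_basic)
  ultimately show ?thesis
    by (simp add: Ham_def abs_sop_hom abs_sop_scale linear_radial inv_sq_radial
        flip: K_op_def abs_generators(1))
qed

text \<open>The coefficients of the spin terms in \<open>H\<close> are such that, over
  \<open>2 r^2\<close>, they complete the angular part \<open>L^2\<close> of the kinetic energy:
  \<open>L^2 + h (X + Y) + (h^2/2) K = J^2 - 3 h^2 / 2\<close>.\<close>

lemma Ham_linear_spherical:
  "abs_sop (Ham h (\<lambda>r. a + b * r)) = scal a + scal b * rr
    + scal (- (h\<^sup>2 / 2)) * (rir * (rir * (rE * rE + rE)))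
    + scal (1 / 2) * (rir * (rir * (rJ2 h - scal (3 / 2 * h\<^sup>2))))"
proof -
  let ?lap = "rd 1 * rd 1 + rd 2 * rd 2 + rd 3 * rd 3"
  have "rir * (rir * (scal (h\<^sup>2) * ((rq 1 * rq 1 + rq 2 * rq 2 + rq 3 * rq 3) * ?lap)))
      = scal (h\<^sup>2) * ((rir * (rir * (rq 1 * rq 1 + rq 2 * rq 2 + rq 3 * rq 3))) * ?lap)"
    by (simp only: mult.assoc scal_left_commute)
  then have "scal (h\<^sup>2) * ?lap = rir * (rir * (scal (h\<^sup>2) * (rE * rE + rE) - rL2 h))"
    by (simp only: ir_q mult_1_left laplace_aux of_real_power)
  also have "\<dots> = scal (h\<^sup>2) * (rir * (rir * (rE * rE + rE))) - rir * (rir * rL2 h)"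
    by (simp only: right_diff_distrib scal_left_commute)
  finally have lap: "scal (h\<^sup>2) * ?lap = \<dots>" .
  show ?thesis
  proof (rule sop_eqI)
    fix \<psi> x i k
    \<comment> \<open>In components the factor \<open>-1/2\<close> in front of \<open>h^2\<close>
      times the Laplacian is handled by complex arithmetic.\<close>
    have "h\<^sup>2 * eval ?lap \<psi> x (i, k) = h\<^sup>2 * eval (rir * (rir * (rE * rE + rE))) \<psi> x (i, k)
        - eval (rir * (rir * rL2 h)) \<psi> x (i, k)"
      using arg_cong[OF lap, of "\<lambda>P. eval P \<psi> x (i, k)"] by (simp only: eval_linear of_real_power)
    then show "eval (abs_sop (Ham h (\<lambda>r. a + b * r))) \<psi> x (i, k) = eval (scal a + scal b * rr
        + scal (- (h\<^sup>2 / 2)) * (rir * (rir * (rE * rE + rE)))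
        + scal (1 / 2) * (rir * (rir * (rJ2 h - scal (3 / 2 * h\<^sup>2))))) \<psi> x (i, k)"
      unfolding abs_Ham_linear J2_eq
      by (simp add: eval_linear eval_coord eval_left_1 mult.assoc algebra_simps power2_eq_square)
        (simp add: field_simps)
  qed
qed

definition commutes :: "sop \<Rightarrow> sop \<Rightarrow> bool" where "commutes P Q \<longleftrightarrow> P * Q = Q * P"

lemma commutes_sym: "commutes P Q \<Longrightarrow> commutes Q P"
  by (simp add: commutes_def)

lemma commutes_intros:
  "commutes P Q \<Longrightarrow> commutes P R \<Longrightarrow> commutes P (Q + R)"
  "commutes P Q \<Longrightarrow> commutes P R \<Longrightarrow> commutes P (Q - R)"
  "commutes P Q \<Longrightarrow> commutes P R \<Longrightarrow> commutes P (Q * R)"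
  "commutes P (scal c)"
  by (simp_all add: commutes_def algebra_simps scal_commute) (metis mult.assoc)

lemma commutes_rr: "commutes P rir \<Longrightarrow> commutes P rr"
  unfolding commutes_def by (metis mult.assoc mult_1_left mult_1_right rr_ir)

lemma commutes_Ham:
  assumes "commutes P rir" "commutes P rE" "commutes P (rJ2 h)"
  shows "commutes P (abs_sop (Ham h (\<lambda>r. a + b * r)))"
  unfolding Ham_linear_spherical by (intro commutes_intros commutes_rr assms)

lemma commutes_basic:
  "commutes rir (rs1 k)" "commutes rir (rs2 k)" "commutes rir (rn k)" "commutes rir (rl h k)"
  "commutes rE (rs1 k)" "commutes rE (rs2 k)" "commutes rE (rn k)" "commutes rE (rl h k)"
  unfolding commutes_def using sigma_commute l_ir euler_sigma euler_n euler_l coord_commute(2)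
  by (simp_all add: rn_def coord_commute coord_commute(2)[THEN reassoc] mult.assoc)

lemma commutes_generators:
  assumes "P \<in> {rj h 1, rj h 2, rj h 3, rK, rN, rA, rB, rX h, rY h, rZ h}"
  shows "commutes P rir" "commutes P rE"
proof -
  have "commutes C P" if "C = rir \<or> C = rE" for C
    using assms that
    by (elim insertE disjE emptyE; simp only:)
      (simp_all only: rj_def op_defs commutes_intros commutes_basic)
  then show "commutes P rir" "commutes P rE" by (auto intro: commutes_sym)
qed

lemma commutes_j_scalar:
  assumes "P \<in> {rK, rN, rA, rB, rX h, rY h, rZ h}"
  shows "commutes P (rj h k)"
  using assms by (auto simp: commutes_def j_scalar j_orbital)

lemma j_order:
  "rj h 2 * rj h 1 = rj h 1 * rj h 2 - scal (\<i> * h) * rj h 3"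
  "rj h 3 * rj h 2 = rj h 2 * rj h 3 - scal (\<i> * h) * rj h 1"
  "rj h 3 * rj h 1 = rj h 1 * rj h 3 + scal (\<i> * h) * rj h 2"
  using j_j[of h] by (simp_all add: algebra_simps)

lemma commutes_j_J2: "commutes (rj h k) (rJ2 h)"
  unfolding commutes_def rJ2_def using exhaust_3[of k]
  by (auto intro!: sop_eqI simp: ring_distribs_assoc j_order j_order[THEN reassoc]
      scal_left_commute[of "rj h k" for h k] scal_mult[THEN reassoc] eval_linear algebra_simps)

lemma commutes_J2:
  assumes "P \<in> {rj h 1, rj h 2, rj h 3, rK, rN, rA, rB, rX h, rY h, rZ h}"
  shows "commutes P (rJ2 h)"
proof -
  consider "P \<in> {rj h 1, rj h 2, rj h 3}" | "P \<in> {rK, rN, rA, rB, rX h, rY h, rZ h}"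
    using assms by blast
  then show ?thesis
  proof cases
    case 1 then show ?thesis using commutes_j_J2 by auto
  next
    case 2 then show ?thesis
      unfolding rJ2_def by (intro commutes_intros commutes_j_scalar)
  qed
qed

lemma commutes_Ham_generators:
  assumes "P \<in> {rj h 1, rj h 2, rj h 3, rK, rN, rA, rB, rX h, rY h, rZ h}"
  shows "commutes (abs_sop (Ham h (\<lambda>r. a + b * r))) P"
  by (intro commutes_sym[OF commutes_Ham] commutes_generators[OF assms] commutes_J2[OF assms])

lemma integral_of_motion_iff:
  assumes "smooth_op H" "smooth_op A"
  shows "integral_of_motion H A \<longleftrightarrow> commutes (abs_sop A) (abs_sop H)"
proof -
  have "integral_of_motion H A \<longleftrightarrow> abs_sop (commutator H A) = abs_sop 0"
    unfolding integral_of_motion_def commutator_def using assms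
    by (subst abs_sop_eq_iff) auto
  then show ?thesis
    using assms by (auto simp: commutator_def abs_sop_hom commutes_def)
qed


lemma integral_of_motion_linear:
  assumes "A \<in> {tot_ang_mom h 1, tot_ang_mom h 2, tot_ang_mom h 3, K_op, YP1 h, YP2 h, YP3 h, YP4 h,
    YP5, YP6, YP7, X_op h, Y_op h, Z_op h}"
  shows "integral_of_motion (Ham h (\<lambda>r. a + b * r)) A"
proof -
  let ?H = "abs_sop (Ham h (\<lambda>r. a + b * r))"
  have gen: "commutes ?H (rj h 1)" "commutes ?H (rj h 2)" "commutes ?H (rj h 3)" "commutes ?H rK" "commutes ?H rN"
    "commutes ?H rA" "commutes ?H rB" "commutes ?H (rX h)" "commutes ?H (rY h)" "commutes ?H (rZ h)"
    by (rule commutes_Ham_generators; simp)+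
  have neg: "commutes ?H (- P)" if "commutes ?H P" for P
    using that by (simp add: commutes_def)
  have "commutes ?H (abs_sop A)"
    using assms by (elim insertE emptyE; simp only: abs_generators abs_YP)
      (intro commutes_intros neg gen)+
  moreover have "smooth_op A" using assms by auto
  ultimately show ?thesis by (simp add: integral_of_motion_iff commutes_sym)
qed

section \<open>Reduction to linear potentials\<close>

definition pointwise_op :: "spinor_op \<Rightarrow> bool" where
  "pointwise_op M \<longleftrightarrow> (\<forall>\<psi> \<phi> x. \<psi> x = \<phi> x \<longrightarrow> M \<psi> x = M \<phi> x)"

text \<open>Order at most one is expressed as dependence on value and derivative at the point. This
  makes sense for fields of any regularity and so applies to the image of a smooth field under
  \<open>H\<close>, which need not be smooth.\<close>

definition first_order_op :: "spinor_op \<Rightarrow> bool" where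
  "first_order_op A \<longleftrightarrow> (\<forall>\<psi> \<phi> x. \<psi> x = \<phi> x \<longrightarrow>
    frechet_derivative \<psi> (at x) = frechet_derivative \<phi> (at x) \<longrightarrow> A \<psi> x = A \<phi> x)"

lemma pointwise_op_comp: "pointwise_op M \<Longrightarrow> pointwise_op M' \<Longrightarrow> pointwise_op (M \<cdot> M')"
  unfolding pointwise_op_def comp_apply by blast

lemma pointwise_op_plus_minus:
  "pointwise_op M \<Longrightarrow> pointwise_op M' \<Longrightarrow> pointwise_op (M + M')"
  "pointwise_op M \<Longrightarrow> pointwise_op M' \<Longrightarrow> pointwise_op (M - M')"
  unfolding pointwise_op_def op_apply by metis+

lemma pointwise_op_basic:
  "pointwise_op (sigma1 k)" "pointwise_op (sigma2 k)" "pointwise_op (pos k)" "pointwise_op (radial f)"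
  by (simp_all add: pointwise_op_def sigma1_def sigma2_def pos_def radial_def)

lemma pointwise_op_inner:
  "(\<And>k. pointwise_op (U k)) \<Longrightarrow> (\<And>k. pointwise_op (V k)) \<Longrightarrow> pointwise_op (op_inner U V)"
  "(\<And>k. pointwise_op (U k)) \<Longrightarrow> (\<And>k. pointwise_op (V k)) \<Longrightarrow> pointwise_op (op_cross U V k)"
  by (simp_all add: op_inner_def op_cross_def sum_3 pointwise_op_comp pointwise_op_plus_minus)

lemmas pointwise_op_intros =
  pointwise_op_comp pointwise_op_plus_minus pointwise_op_basic pointwise_op_inner

text \<open>Compositions are covered only with the pointwise factor on the left; in all operators
  concerned the momenta stand rightmost.\<close>

lemma first_order_op_intros:
  "pointwise_op M \<Longrightarrow> first_order_op M"
  "pointwise_op M \<Longrightarrow> first_order_op A \<Longrightarrow> first_order_op (M \<cdot> A)"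
  "first_order_op A \<Longrightarrow> first_order_op B \<Longrightarrow> first_order_op (A + B)"
  "first_order_op A \<Longrightarrow> first_order_op B \<Longrightarrow> first_order_op (A - B)"
  "first_order_op A \<Longrightarrow> first_order_op (- A)"
  "first_order_op A \<Longrightarrow> first_order_op (c *\<^sub>o A)"
proof -
  show "first_order_op M" if "pointwise_op M"
    using that unfolding first_order_op_def pointwise_op_def by blast
  show "first_order_op (M \<cdot> A)" if "pointwise_op M" "first_order_op A"
    unfolding first_order_op_def comp_apply
  proof (intro allI impI)
    fix \<psi> \<phi> :: "real^3 \<Rightarrow> spinor" and x :: "real^3"
    assume "\<psi> x = \<phi> x" "frechet_derivative \<psi> (at x) = frechet_derivative \<phi> (at x)"
    then have "A \<psi> x = A \<phi> x" using that(2) unfolding first_order_op_def by blast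
    then show "M (A \<psi>) x = M (A \<phi>) x" using that(1) unfolding pointwise_op_def by blast
  qed
qed (unfold first_order_op_def op_apply, metis+)

lemma first_order_op_mom: "first_order_op (mom h k)"
  unfolding first_order_op_def mom_def op_apply partial_deriv_def by simp

lemma first_order_op_inner:
  "(\<And>k. pointwise_op (U k)) \<Longrightarrow> (\<And>k. first_order_op (W k)) \<Longrightarrow> first_order_op (op_inner U W)"
  "(\<And>k. pointwise_op (U k)) \<Longrightarrow> (\<And>k. first_order_op (W k)) \<Longrightarrow> first_order_op (op_cross U W k)"
  by (simp_all add: op_inner_def op_cross_def sum_3 first_order_op_intros)

lemma first_order_op_generators:
  assumes "A \<in> {tot_ang_mom h 1, tot_ang_mom h 2, tot_ang_mom h 3, K_op, YP1 h, YP2 h, YP3 h, YP4 h,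
    YP5, YP6, YP7, X_op h, Y_op h, Z_op h}"
  shows "first_order_op A"
proof -
  have am: "first_order_op (ang_mom h k)" for k
    by (simp add: ang_mom_def first_order_op_inner first_order_op_mom pointwise_op_intros)
  have tam: "first_order_op (tot_ang_mom h k)" for k
    by (simp add: tot_ang_mom_def am first_order_op_intros pointwise_op_intros)
  note intros = am first_order_op_mom first_order_op_inner first_order_op_intros pointwise_op_intros
  have "first_order_op K_op" "first_order_op YP5" "first_order_op YP6" "first_order_op YP7"
    by (simp_all add: K_op_def YP5_def YP6_def YP7_def first_order_op_intros(1) pointwise_op_intros)
  moreover have "first_order_op (X_op h)" "first_order_op (Y_op h)" "first_order_op (Z_op h)"
    by (simp_all add: X_op_def Y_op_def Z_op_def intros)
  moreover have "first_order_op (YP1 h)" "first_order_op (YP2 h)" "first_order_op (YP3 h)" "first_order_op (YP4 h)"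
    by (simp_all add: YP1_def YP2_def YP3_def YP4_def intros)
  ultimately show ?thesis using assms tam by auto
qed

lemma integral_of_motion_reduce_potential:
  assumes V0: "V0 differentiable_on {0<..}"
    and A: "smooth_op A" "first_order_op A"
    and lin: "\<And>a b. integral_of_motion (Ham h (\<lambda>r. a + b * r)) A"
  shows "integral_of_motion (Ham h V0) A"
  unfolding integral_of_motion_def op_eq_def
proof (intro allI impI)
  fix \<psi> :: "real^3 \<Rightarrow> spinor" and x :: "real^3"
  assume s: "smooth_off_origin \<psi>" and x: "x \<noteq> 0"
  have r: "norm x \<in> {0<..}" using x by simp
  have "V0 differentiable (at (norm x))"
    using V0 r differentiable_on_eq_differentiable_at[of "{0<..}" V0] by auto
  then obtain D where D: "(V0 has_real_derivative D) (at (norm x))"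
    using real_differentiable_def by blast
  \<comment> \<open>The tangent line of \<open>V0\<close> at \<open>norm x\<close>, so that
    \<open>g\<close> vanishes at \<open>x\<close> together with its derivative.\<close>
  define f where "f = (\<lambda>r. (V0 (norm x) - D * norm x) + D * r)"
  define g where "g = (\<lambda>y::real^3. V0 (norm y) - f (norm y))"
  have diff: "Ham h V0 \<phi> y = Ham h f \<phi> y + g y *\<^sub>R \<phi> y" for \<phi> y
    by (simp add: Ham_def op_apply radial_def g_def scaleR_eq_vector_scale vec_eq_iff algebra_simps)
  have g0: "g x = 0" by (simp add: g_def f_def)
  have "((\<lambda>r. V0 r - f r) has_real_derivative 0) (at (norm x))"
    unfolding f_def using D by (auto intro!: derivative_eq_intros)
  then have "((\<lambda>r. V0 r - f r) has_derivative (\<lambda>h. 0)) (at (norm x))"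
    by (simp add: has_field_derivative_def lambda_zero)
  from diff_chain_at[OF has_derivative_norm[OF x] this]
  have g': "(g has_derivative (\<lambda>h. 0)) (at x)"
    by (simp add: g_def o_def)
  have sH: "smooth_off_origin (Ham h f \<psi>)"
    unfolding f_def by (rule smooth_op_smooth[OF _ s]) simp
  have H': "(Ham h f \<psi> has_derivative frechet_derivative (Ham h f \<psi>) (at x)) (at x)"
    using smooth_imp_differentiable[OF sH x] by (simp add: frechet_derivative_works)
  have "(\<psi> has_derivative frechet_derivative \<psi> (at x)) (at x)"
    using smooth_imp_differentiable[OF s x] by (simp add: frechet_derivative_works)
  from has_derivative_add[OF H' has_derivative_scaleR[OF g' this]]
  have "(Ham h V0 \<psi> has_derivative frechet_derivative (Ham h f \<psi>) (at x)) (at x)"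
    by (simp add: diff[abs_def] g0)
  then have "frechet_derivative (Ham h V0 \<psi>) (at x) = frechet_derivative (Ham h f \<psi>) (at x)"
    by (rule frechet_derivative_at[symmetric])
  moreover have "Ham h V0 \<psi> x = Ham h f \<psi> x"
    by (simp add: diff g0)
  \<comment> \<open>This settles the term in which \<open>A\<close> acts last. Where the Hamiltonian
    acts last, \<open>g x = 0\<close> is enough.\<close>
  ultimately have "A (Ham h V0 \<psi>) x = A (Ham h f \<psi>) x"
    using A(2) unfolding first_order_op_def by blast
  then have "commutator (Ham h V0) A \<psi> x = commutator (Ham h f) A \<psi> x"
    by (simp add: commutator_def op_apply diff g0)
  also have "\<dots> = 0"
    using lin s x unfolding f_def integral_of_motion_def op_eq_def by (simp add: op_apply)
  finally show "commutator (Ham h V0) A \<psi> x = (0 :: spinor_op) \<psi> x" by (simp add: op_apply)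
qed

lemma integral_of_motion_generators:
  assumes "V0 differentiable_on {0<..}"
    and "A \<in> {tot_ang_mom h 1, tot_ang_mom h 2, tot_ang_mom h 3, K_op, YP1 h, YP2 h, YP3 h, YP4 h,
      YP5, YP6, YP7, X_op h, Y_op h, Z_op h}"
  shows "integral_of_motion (Ham h V0) A"
proof (rule integral_of_motion_reduce_potential[OF assms(1)])
  show "smooth_op A" using assms(2) by auto
qed (use assms(2) in \<open>rule first_order_op_generators integral_of_motion_linear; assumption\<close>)+

section \<open>Ordered polynomials in the generators\<close>

lemma ordered_polynomials_monomial:
  assumes "length es = length As"
  shows "ordered_monomial As es \<in> ordered_polynomials As"
proof -
  have "ordered_monomial As es = (\<Sum>es\<in>{es}. 1 *\<^sub>o ordered_monomial As es)"
    by (simp add: fun_eq_iff op_apply)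
  then show ?thesis
    unfolding ordered_polynomials_def mem_Collect_eq
    by (intro exI[of _ "{es}"] exI[of _ "\<lambda>_. 1"] conjI) (use assms in auto)
qed

lemma op_scale_sum: "c *\<^sub>o (\<Sum>i\<in>I. A i) = (\<Sum>i\<in>I. c *\<^sub>o A i)"
  by (induction I rule: infinite_finite_induct)
    (simp_all add: fun_eq_iff op_apply vector_add_ldistrib)

lemma ordered_polynomials_scale:
  assumes "P \<in> ordered_polynomials As" shows "c *\<^sub>o P \<in> ordered_polynomials As"
proof -
  obtain M a where M: "finite M" "M \<subseteq> {es. length es = length As}"
    and P: "P = (\<Sum>es\<in>M. a es *\<^sub>o ordered_monomial As es)"
    using assms unfolding ordered_polynomials_def by blast
  have "c *\<^sub>o P = (\<Sum>es\<in>M. (c * a es) *\<^sub>o ordered_monomial As es)"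
    unfolding P op_scale_sum
    by (rule sum.cong) (simp_all add: fun_eq_iff op_apply vector_smult_assoc)
  then show ?thesis using M unfolding ordered_polynomials_def by fast
qed

lemma ordered_polynomials_add:
  assumes "P \<in> ordered_polynomials As" "Q \<in> ordered_polynomials As"
  shows "P + Q \<in> ordered_polynomials As"
proof -
  obtain M a where M: "finite M" "M \<subseteq> {es. length es = length As}"
    and P: "P = (\<Sum>es\<in>M. a es *\<^sub>o ordered_monomial As es)"
    using assms unfolding ordered_polynomials_def by blast
  obtain M' b where M': "finite M'" "M' \<subseteq> {es. length es = length As}"
    and Q: "Q = (\<Sum>es\<in>M'. b es *\<^sub>o ordered_monomial As es)"
    using assms unfolding ordered_polynomials_def by blast
  let ?c = "\<lambda>es. (if es \<in> M then a es else 0)" and ?d = "\<lambda>es. (if es \<in> M' then b es else 0)"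
  have "P = (\<Sum>es\<in>M \<union> M'. ?c es *\<^sub>o ordered_monomial As es)"
    unfolding P using M(1) M'(1)
    by (intro sum.mono_neutral_cong_left) (auto simp: fun_eq_iff op_apply)
  moreover have "Q = (\<Sum>es\<in>M \<union> M'. ?d es *\<^sub>o ordered_monomial As es)"
    unfolding Q using M(1) M'(1)
    by (intro sum.mono_neutral_cong_left) (auto simp: fun_eq_iff op_apply)
  ultimately have "P + Q = (\<Sum>es\<in>M \<union> M'. (?c es + ?d es) *\<^sub>o ordered_monomial As es)"
    by (simp only: sum.distrib[symmetric]) (rule sum.cong, auto simp: fun_eq_iff op_apply vec_eq_iff distrib_right)
  moreover have "finite (M \<union> M')" "M \<union> M' \<subseteq> {es. length es = length As}"
    using M M' by auto
  ultimately show ?thesis unfolding ordered_polynomials_def by fast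
qed

abbreviation generators :: "real \<Rightarrow> spinor_op list" where
  "generators h \<equiv> [tot_ang_mom h 1, tot_ang_mom h 2, tot_ang_mom h 3, K_op, YP5, YP6, YP7,
    X_op h, Y_op h, Z_op h]"

text \<open>A smooth representative is required so that membership can be carried back to
  \<open>\<doteq>\<close> between operators.\<close>

definition rpoly :: "real \<Rightarrow> sop set" where
  "rpoly h = {abs_sop P | P. P \<in> ordered_polynomials (generators h) \<and> smooth_op P}"

lemma rpoly_closed:
  assumes "P \<in> rpoly h"
  shows "scal c * P \<in> rpoly h" "- P \<in> rpoly h"
    and "Q \<in> rpoly h \<Longrightarrow> P + Q \<in> rpoly h" "Q \<in> rpoly h \<Longrightarrow> P - Q \<in> rpoly h"
proof -
  have s: "scal c * P \<in> rpoly h" if P: "P \<in> rpoly h" for c P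
  proof -
    obtain P' where "P = abs_sop P'" "P' \<in> ordered_polynomials (generators h)" "smooth_op P'"
      using P unfolding rpoly_def by blast
    then have "scal c * P = abs_sop (c *\<^sub>o P')" "c *\<^sub>o P' \<in> ordered_polynomials (generators h)"
      "smooth_op (c *\<^sub>o P')"
      by (simp_all add: abs_sop_scale ordered_polynomials_scale)
    then show ?thesis unfolding rpoly_def by blast
  qed
  have p: "P + Q \<in> rpoly h" if P: "P \<in> rpoly h" and Q: "Q \<in> rpoly h" for P Q
  proof -
    obtain P' where "P = abs_sop P'" "P' \<in> ordered_polynomials (generators h)" "smooth_op P'"
      using P unfolding rpoly_def by blast
    moreover obtain Q' where "Q = abs_sop Q'" "Q' \<in> ordered_polynomials (generators h)" "smooth_op Q'"
      using Q unfolding rpoly_def by blast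
    ultimately have "P + Q = abs_sop (P' + Q')" "P' + Q' \<in> ordered_polynomials (generators h)"
      "smooth_op (P' + Q')"
      by (simp_all add: abs_sop_hom ordered_polynomials_add)
    then show ?thesis unfolding rpoly_def by blast
  qed
  have m: "- P = scal (- 1) * P" for P
    by (simp add: scal_1 flip: scal_minus)
  show "scal c * P \<in> rpoly h" "- P \<in> rpoly h" using assms s m by auto
  show "P + Q \<in> rpoly h" "P - Q \<in> rpoly h" if "Q \<in> rpoly h"
    using p[OF assms that] p[OF assms s[OF that, of "- 1"]] by (simp_all flip: m)
qed

lemma rpoly_monomial:
  assumes "length es = 10"
  shows "abs_sop (ordered_monomial (generators h) es) \<in> rpoly h"
proof -
  have f: "smooth_op (A ^^ e)" if "smooth_op A" for A e
    by (induction e) (simp_all only: funpow.simps smooth_op_intros that)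
  have "smooth_op (ordered_monomial As es)" if "\<forall>A\<in>set As. smooth_op A" for As
    using that unfolding ordered_monomial_def
    by (induction As es rule: list_induct2') (auto simp: f)
  then show ?thesis
    using assms ordered_polynomials_monomial[of es "generators h"] unfolding rpoly_def by force
qed

text \<open>Only linear closure of \<open>rpoly\<close> is available, so the ordered monomials that
  occur on the right-hand sides of the commutators are supplied one by one.\<close>

lemma rpoly_base:
  "1 \<in> rpoly h" "rj h 1 \<in> rpoly h" "rj h 2 \<in> rpoly h" "rj h 3 \<in> rpoly h"
  "rK \<in> rpoly h" "rN \<in> rpoly h" "rA \<in> rpoly h" "rB - rA \<in> rpoly h"
  "rX h \<in> rpoly h" "rY h \<in> rpoly h" "rZ h \<in> rpoly h"
  "rj h 1 * (rj h 1 * rK) \<in> rpoly h" "rj h 2 * (rj h 2 * rK) \<in> rpoly h" "rj h 3 * (rj h 3 * rK) \<in> rpoly h"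
  "rK * rK \<in> rpoly h" "rK * rX h \<in> rpoly h" "rK * rY h \<in> rpoly h"
  "rN * rN \<in> rpoly h" "rN * rX h \<in> rpoly h" "rN * rY h \<in> rpoly h"
  "rA * rX h \<in> rpoly h" "rA * rY h \<in> rpoly h" "rA * rZ h \<in> rpoly h"
  "(rB - rA) * rX h \<in> rpoly h" "(rB - rA) * rY h \<in> rpoly h" "(rB - rA) * rZ h \<in> rpoly h"
  "rX h * rY h \<in> rpoly h"
proof -
  \<comment> \<open>The ten exponents belong in turn to the three \<open>J_i\<close>,
    \<open>K\<close>, \<open>YP5\<close>, \<open>YP6\<close>, \<open>YP7\<close>, \<open>X\<close>,
    \<open>Y\<close> and \<open>Z\<close>.\<close>
  have *: "(let m = ordered_monomial (generators h) [a1,a2,a3,a4,a5,a6,a7,a8,a9,a10] in abs_sop m) \<in> rpoly h"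
    for a1 a2 a3 a4 a5 a6 a7 a8 a9 a10
    using rpoly_monomial[of "[a1,a2,a3,a4,a5,a6,a7,a8,a9,a10]" h] by simp
  note ** = *[unfolded Let_def ordered_monomial_def, simplified]
  note simps = abs_sop_hom abs_generators
  let ?s = "Suc 0"
  show "1 \<in> rpoly h" "rj h 1 \<in> rpoly h" "rj h 2 \<in> rpoly h" "rj h 3 \<in> rpoly h"
    "rK \<in> rpoly h" "rN \<in> rpoly h" "rA \<in> rpoly h" "rB - rA \<in> rpoly h"
    "rX h \<in> rpoly h" "rY h \<in> rpoly h" "rZ h \<in> rpoly h"
    using **[of 0 0 0 0 0 0 0 0 0 0] **[of ?s 0 0 0 0 0 0 0 0 0] **[of 0 ?s 0 0 0 0 0 0 0 0]
      **[of 0 0 ?s 0 0 0 0 0 0 0] **[of 0 0 0 ?s 0 0 0 0 0 0] **[of 0 0 0 0 ?s 0 0 0 0 0]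
      **[of 0 0 0 0 0 ?s 0 0 0 0] **[of 0 0 0 0 0 0 ?s 0 0 0] **[of 0 0 0 0 0 0 0 ?s 0 0]
      **[of 0 0 0 0 0 0 0 0 ?s 0] **[of 0 0 0 0 0 0 0 0 0 ?s]
    by (simp_all add: simps)
  show "rj h 1 * (rj h 1 * rK) \<in> rpoly h" "rj h 2 * (rj h 2 * rK) \<in> rpoly h"
    "rj h 3 * (rj h 3 * rK) \<in> rpoly h" "rK * rK \<in> rpoly h" "rN * rN \<in> rpoly h"
    using **[of "Suc ?s" 0 0 ?s 0 0 0 0 0 0] **[of 0 "Suc ?s" 0 ?s 0 0 0 0 0 0]
      **[of 0 0 "Suc ?s" ?s 0 0 0 0 0 0] **[of 0 0 0 "Suc ?s" 0 0 0 0 0 0]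
      **[of 0 0 0 0 "Suc ?s" 0 0 0 0 0]
    by (simp_all add: simps mult.assoc)
  show "rK * rX h \<in> rpoly h" "rK * rY h \<in> rpoly h" "rN * rX h \<in> rpoly h" "rN * rY h \<in> rpoly h"
    "rA * rX h \<in> rpoly h" "rA * rY h \<in> rpoly h" "rA * rZ h \<in> rpoly h"
    using **[of 0 0 0 ?s 0 0 0 ?s 0 0] **[of 0 0 0 ?s 0 0 0 0 ?s 0] **[of 0 0 0 0 ?s 0 0 ?s 0 0]
      **[of 0 0 0 0 ?s 0 0 0 ?s 0] **[of 0 0 0 0 0 ?s 0 ?s 0 0] **[of 0 0 0 0 0 ?s 0 0 ?s 0]
      **[of 0 0 0 0 0 ?s 0 0 0 ?s]
    by (simp_all add: simps)
  show "(rB - rA) * rX h \<in> rpoly h" "(rB - rA) * rY h \<in> rpoly h" "(rB - rA) * rZ h \<in> rpoly h"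
    "rX h * rY h \<in> rpoly h"
    using **[of 0 0 0 0 0 0 ?s ?s 0 0] **[of 0 0 0 0 0 0 ?s 0 ?s 0] **[of 0 0 0 0 0 0 ?s 0 0 ?s]
      **[of 0 0 0 0 0 0 0 ?s ?s 0]
    by (simp_all add: simps)
qed


section \<open>Commutators as ordered polynomials\<close>

definition poly_comm :: "real \<Rightarrow> sop \<Rightarrow> sop \<Rightarrow> bool" where
  "poly_comm h P Q \<longleftrightarrow> P * Q - Q * P \<in> rpoly h"

lemma poly_comm_sym: "poly_comm h P Q \<Longrightarrow> poly_comm h Q P"
  unfolding poly_comm_def using rpoly_closed(2)[of "P * Q - Q * P" h] by simp

lemma rpoly_0: "0 \<in> rpoly h"
  using rpoly_closed(4)[OF rpoly_base(1) rpoly_base(1)] by simp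

lemma poly_comm_comm: "commutes P Q \<Longrightarrow> poly_comm h P Q"
  by (simp add: poly_comm_def commutes_def rpoly_0)

lemma poly_comm_diff: "poly_comm h P Q \<Longrightarrow> poly_comm h P R \<Longrightarrow> poly_comm h P (Q - R)"
  unfolding poly_comm_def using rpoly_closed(4)[of "P * Q - Q * P" h "P * R - R * P"]
  by (simp add: algebra_simps)

text \<open>This removes the product \<open>A B\<close> in favour of \<open>N^2\<close>. It is the
  origin of \<open>K - 1 + N^2 / 2\<close> in the theorem, which is \<open>K - A B\<close>.\<close>

lemma A_B_eq: "rA * rB = 1 - scal (1 / 2) * (rN * rN)"
proof (rule sop_eqI)
  fix \<psi> x i k
  have "eval (rN * rN) \<psi> x (i, k) = 2 * (eval 1 \<psi> x (i, k) - eval (rA * rB) \<psi> x (i, k))"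
    by (simp add: N_N n_sum_sq eval_linear)
  then show "eval (rA * rB) \<psi> x (i, k) = eval (1 - scal (1 / 2) * (rN * rN)) \<psi> x (i, k)"
    by (simp add: eval_linear field_simps)
qed

lemma orbital_N:
  "rY h * rN - rN * rY h = scal (- 2 * \<i>) * (rA * rX h) + scal (- h) * rN + scal (- 2 * \<i> * h) * rB"
  "rX h * rN - rN * rX h = scal (2 * \<i>) * (rB * rY h) + scal (- h) * rN + scal (2 * \<i> * h) * rA"
  using orbital_N_aux[of h] by (simp_all add: n_l)

lemma orbital_matrix_simp:
  "rY h * rA - rA * rY h = scal (- 2) * (rA * rY h) + scal (- 2 * h) * rA"
  "rX h * rB - rB * rX h = scal (- 2) * (rB * rX h) + scal (- 2 * h) * rB"
  using orbital_matrix[of h] by (simp_all add: n_l)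

lemma poly_comm_generators:
  "poly_comm h rK rN" "poly_comm h rK rA" "poly_comm h rK rB"
  "poly_comm h rK (rX h)" "poly_comm h rK (rY h)" "poly_comm h rK (rZ h)"
  "poly_comm h rA rN" "poly_comm h rB rN" "poly_comm h rA rB"
  "poly_comm h (rX h) rN" "poly_comm h (rX h) rA" "poly_comm h (rX h) rB"
  "poly_comm h (rY h) rN" "poly_comm h (rY h) rA" "poly_comm h (rY h) rB"
  "poly_comm h (rZ h) rN" "poly_comm h (rZ h) rA" "poly_comm h (rZ h) rB"
  "poly_comm h (rY h) (rX h)" "poly_comm h (rY h) (rZ h)" "poly_comm h (rX h) (rZ h)"
  "poly_comm h (rj h 1) (rj h 2)" "poly_comm h (rj h 2) (rj h 3)" "poly_comm h (rj h 3) (rj h 1)"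
proof -
  note base = rpoly_base[of h]
  \<comment> \<open>\<open>B\<close> is not a generator; it is \<open>YP6 + YP7\<close>, so
    \<open>B P\<close> is assembled from two ordered monomials.\<close>
  have B: "rB * P \<in> rpoly h" if "rA * P \<in> rpoly h" "(rB - rA) * P \<in> rpoly h" for P
    using rpoly_closed(3)[OF that] by (simp add: left_diff_distrib)
  have B1: "rB \<in> rpoly h" using rpoly_closed(3)[OF base(7,8)] by simp
  \<comment> \<open>\<open>Y X\<close> is in the wrong order; it is
    \<open>X Y + i h Z\<close>.\<close>
  have YX: "rY h * rX h \<in> rpoly h"
    using rpoly_closed(3)[OF rpoly_closed(1)[OF base(11), of "\<i> * h"] base(27)] orbital_orbital(1)[of h]
    by (simp add: algebra_simps)
  \<comment> \<open>The order puts the \<open>J_i\<close> before \<open>K\<close>, and they commute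
    with it.\<close>
  have KJ: "rK * (rJ2 h) = rj h 1 * (rj h 1 * rK) + rj h 2 * (rj h 2 * rK) + rj h 3 * (rj h 3 * rK)"
    by (simp add: rJ2_def distrib_left mult.assoc j_scalar(1)) (metis j_scalar(1) mult.assoc)
  have s1: "scal c \<in> rpoly h" for c using rpoly_closed(1)[OF base(1), of c] by simp
  have KL: "rK * rL2 h \<in> rpoly h"
    unfolding J2_eq right_diff_distrib distrib_left KJ
    unfolding scal_left_commute[of rK] scal_commute[of rK] distrib_left
    by (intro rpoly_closed base s1)
  note intros = rpoly_closed base B B1 YX KL s1
  show "poly_comm h rK rN" "poly_comm h rK rA" "poly_comm h rK rB"
    "poly_comm h rK (rX h)" "poly_comm h rK (rY h)" "poly_comm h rK (rZ h)"
    "poly_comm h (rX h) rN" "poly_comm h (rX h) rA" "poly_comm h (rX h) rB"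
    "poly_comm h (rY h) rN" "poly_comm h (rY h) rA" "poly_comm h (rY h) rB"
    "poly_comm h (rY h) (rX h)" "poly_comm h (rj h 1) (rj h 2)" "poly_comm h (rj h 2) (rj h 3)"
    "poly_comm h (rj h 3) (rj h 1)"
    unfolding poly_comm_def matrix_relations K_orbital orbital_N orbital_matrix_simp
      orbital_matrix(3,4) orbital_orbital(1) j_j
    by (intro intros)+
  show "poly_comm h rA rN" "poly_comm h rB rN" "poly_comm h rA rB"
    unfolding poly_comm_def A_N B_N n_sum_sq mult_1_right matrix_relations(4)[symmetric] diff_self A_B_eq
    by (intro intros rpoly_0)+
  show "poly_comm h (rZ h) rN" "poly_comm h (rZ h) rA" "poly_comm h (rZ h) rB"
    unfolding poly_comm_def Z_matrix_aux n_l mult_zero_right add_0_right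
    by (intro intros)+
  show "poly_comm h (rY h) (rZ h)" "poly_comm h (rX h) (rZ h)"
    unfolding poly_comm_def orbital_orbital(2,3)
    by (intro intros)+
qed

lemma poly_comm_all:
  assumes "P \<in> {rj h 1, rj h 2, rj h 3, rK, rN, rA, rB - rA, rX h, rY h, rZ h}"
    and "Q \<in> {rj h 1, rj h 2, rj h 3, rK, rN, rA, rB - rA, rX h, rY h, rZ h}"
  shows "poly_comm h P Q"
proof -
  have self: "poly_comm h P P" for P by (simp add: poly_comm_def rpoly_0)
  have j: "poly_comm h P (rj h k)" if "P \<in> {rK, rN, rA, rB, rX h, rY h, rZ h}" for P k
    by (rule poly_comm_comm[OF commutes_j_scalar[OF that]])
  note g = poly_comm_generators[of h] j[THEN poly_comm_sym]
  show ?thesis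
    using assms
    by (elim insertE emptyE; simp only: g g[THEN poly_comm_sym] self poly_comm_diff
        poly_comm_diff[THEN poly_comm_sym] insert_iff simp_thms)
qed

lemma finite_polynomial_symmetry_algebra_gens:
  assumes "V0 differentiable_on {0<..}"
  shows "finite_polynomial_symmetry_algebra (Ham h V0) (generators h)"
  unfolding finite_polynomial_symmetry_algebra_def
proof (intro conjI ballI)
  fix A assume A: "A \<in> set (generators h)"
  then show "integral_of_motion (Ham h V0) A"
    by (intro integral_of_motion_generators[OF assms]) auto
  fix B assume B: "B \<in> set (generators h)"
  have gen: "smooth_op C" "abs_sop C \<in> {rj h 1, rj h 2, rj h 3, rK, rN, rA, rB - rA, rX h, rY h, rZ h}"
    if "C \<in> set (generators h)" for C
    using that by (auto simp: abs_generators)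
  have c: "smooth_op (commutator A B)"
    using gen(1) A B by (simp add: commutator_def)
  have "abs_sop (commutator A B) \<in> rpoly h"
    using poly_comm_all[OF gen(2)[OF A] gen(2)[OF B]] gen(1) A B
    by (simp only: commutator_def abs_sop_hom smooth_op_intros poly_comm_def)
  then show "\<exists>P\<in>ordered_polynomials (generators h). commutator A B \<doteq> P"
    using abs_sop_eq_iff[OF c] unfolding rpoly_def by blast
qed

section \<open>The stated identities\<close>

lemma op_eqI: "smooth_op P \<Longrightarrow> smooth_op Q \<Longrightarrow> abs_sop P = abs_sop Q \<Longrightarrow> P \<doteq> Q"
  by (simp add: abs_sop_eq_iff)

lemma smooth_op_commutator [simp]: "smooth_op P \<Longrightarrow> smooth_op Q \<Longrightarrow> smooth_op (commutator P Q)"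
  by (simp add: commutator_def)

lemma abs_sop_commutator:
  "smooth_op P \<Longrightarrow> smooth_op Q \<Longrightarrow>
    abs_sop (commutator P Q) = abs_sop P * abs_sop Q - abs_sop Q * abs_sop P"
  by (simp add: commutator_def abs_sop_hom)

lemma commutator_diff:
  "P * (Q - R) - (Q - R) * P = (P * Q - Q * P) - (P * R - R * (P :: sop))"
  "(Q - R) * P - P * (Q - R) = (Q * P - P * Q) - (R * P - P * (R :: sop))"
  by (simp_all add: algebra_simps)

text \<open>Products of \<open>A\<close>, \<open>B\<close>, \<open>K\<close>, \<open>X\<close>,
  \<open>Y\<close>, \<open>N\<close> stay atoms here. Evaluation turns the elements
  \<open>scal c\<close> in front of them into complex coefficients, which can be collected, whereas
  in the noncommutative ring \<open>scal a * P + scal b * P\<close> stays as it is.\<close>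

lemmas eval_scal_linear = eval_linear eval_left_1 ring_distribs_assoc scal_mult[THEN reassoc]
  scal_commute[of rA] scal_commute[of rB] scal_commute[of rK]
  scal_left_commute[of rA] scal_left_commute[of rB] scal_left_commute[of rK]

theorem proposition3:
  fixes hbar :: real and V0 :: "real \<Rightarrow> real"
  assumes "hbar > 0" and "V0 differentiable_on {0<..}"
  shows
    "(\<forall>A\<in>{K_op, YP1 hbar, YP2 hbar, YP3 hbar, YP4 hbar, YP5, YP6, YP7}.
        integral_of_motion (Ham hbar V0) A) \<and>
     finite_polynomial_symmetry_algebra (Ham hbar V0)
       ([tot_ang_mom hbar 1, tot_ang_mom hbar 2, tot_ang_mom hbar 3] @
        [K_op, YP5, YP6, YP7, X_op hbar, Y_op hbar, Z_op hbar]) \<and>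

     commutator K_op YP6 \<doteq> (2 * \<i>) *\<^sub>o YP5 \<and>
     commutator K_op YP5 \<doteq> (4 * \<i>) *\<^sub>o YP7 \<and>
     commutator K_op YP7 \<doteq> (- 4 * \<i>) *\<^sub>o YP5 \<and>
     commutator YP6 YP7 \<doteq> 0 \<and>
     commutator YP6 YP5 \<doteq> (2 * \<i>) *\<^sub>o (K_op - id + (1 / 2) *\<^sub>o (YP5 \<cdot> YP5)) \<and>
     commutator YP7 YP5 \<doteq> (- 4 * \<i>) *\<^sub>o (K_op - id + (1 / 2) *\<^sub>o (YP5 \<cdot> YP5)) \<and>

     commutator K_op (Y_op hbar) \<doteq> (2 * \<i>) *\<^sub>o Z_op hbar \<and>
     commutator K_op (X_op hbar) \<doteq> (- 2 * \<i>) *\<^sub>o Z_op hbar \<and>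
     commutator K_op (Z_op hbar) \<doteq> (4 * \<i>) *\<^sub>o (X_op hbar - Y_op hbar) \<and>
     commutator (Y_op hbar) (X_op hbar) \<doteq> (\<i> * hbar) *\<^sub>o Z_op hbar \<and>
     commutator (Y_op hbar) YP6 \<doteq> (2 * \<i>) *\<^sub>o YP3 hbar \<and>
     commutator (X_op hbar) YP6 \<doteq> (- \<i> * hbar) *\<^sub>o YP5 \<and>
     commutator (Y_op hbar) YP7 \<doteq> (\<i> * hbar) *\<^sub>o YP5 - (2 * \<i>) *\<^sub>o YP3 hbar \<and>
     commutator (X_op hbar) YP7 \<doteq> (- 2 * \<i>) *\<^sub>o YP2 hbar + (\<i> * hbar) *\<^sub>o YP5 \<and>
     commutator (Y_op hbar) YP5 \<doteq>
       (2 * \<i>) *\<^sub>o YP1 hbar - (2 * \<i> * hbar) *\<^sub>o (YP6 + YP7) \<and>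
     commutator (X_op hbar) YP5 \<doteq>
       (- 2 * \<i>) *\<^sub>o (YP1 hbar + YP4 hbar) + (2 * \<i> * hbar) *\<^sub>o YP6 \<and>

     commutator (Y_op hbar) (Z_op hbar) \<doteq>
       (2 * \<i>) *\<^sub>o (K_op \<cdot> L_sq hbar)
       - \<i> *\<^sub>o (Y_op hbar \<cdot> X_op hbar + X_op hbar \<cdot> Y_op hbar)
       - (2 * \<i> * hbar) *\<^sub>o X_op hbar \<and>
     commutator (X_op hbar) (Z_op hbar) \<doteq>
       (- 2 * \<i>) *\<^sub>o (K_op \<cdot> L_sq hbar)
       + \<i> *\<^sub>o (Y_op hbar \<cdot> X_op hbar + X_op hbar \<cdot> Y_op hbar)
       + (2 * \<i> * hbar) *\<^sub>o Y_op hbar \<and>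
     L_sq hbar \<doteq>
       J_sq hbar - hbar *\<^sub>o (X_op hbar + Y_op hbar) - (hbar\<^sup>2 / 4) *\<^sub>o (6 *\<^sub>o id + 2 *\<^sub>o K_op) \<and>

     YP1 hbar \<doteq> - (YP6 \<cdot> X_op hbar) + (\<i> * hbar / 2) *\<^sub>o YP5 \<and>
     YP2 hbar \<doteq> (- \<i>) *\<^sub>o ((YP6 + YP7) \<cdot> (X_op hbar + hbar *\<^sub>o id)) \<and>
     YP3 hbar \<doteq> \<i> *\<^sub>o (YP6 \<cdot> (Y_op hbar + hbar *\<^sub>o id)) \<and>
     YP4 hbar \<doteq>
       YP6 \<cdot> X_op hbar - (YP6 + YP7) \<cdot> Y_op hbar - (\<i> * hbar) *\<^sub>o YP5"
proof -
  note abs = abs_sop_commutator abs_sop_hom abs_sop_scale abs_generators abs_YP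
  have "\<forall>A\<in>{K_op, YP1 hbar, YP2 hbar, YP3 hbar, YP4 hbar, YP5, YP6, YP7}.
        integral_of_motion (Ham hbar V0) A"
    by (intro ballI integral_of_motion_generators[OF assms(2)]) auto
  moreover have "finite_polynomial_symmetry_algebra (Ham hbar V0)
       ([tot_ang_mom hbar 1, tot_ang_mom hbar 2, tot_ang_mom hbar 3] @
        [K_op, YP5, YP6, YP7, X_op hbar, Y_op hbar, Z_op hbar])"
    using finite_polynomial_symmetry_algebra_gens[OF assms(2)] by simp
  moreover have "commutator K_op YP6 \<doteq> (2 * \<i>) *\<^sub>o YP5"
    by (rule op_eqI) (simp_all add: abs matrix_relations)
  moreover have "commutator K_op YP5 \<doteq> (4 * \<i>) *\<^sub>o YP7"
    by (rule op_eqI) (simp_all add: abs matrix_relations)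
  moreover have "commutator K_op YP7 \<doteq> (- 4 * \<i>) *\<^sub>o YP5"
    by (rule op_eqI; (simp add: abs commutator_diff matrix_relations)?)
      (rule sop_eqI, simp add: eval_scal_linear)
  moreover have "commutator YP6 YP7 \<doteq> 0"
    by (rule op_eqI) (simp_all add: abs commutator_diff matrix_relations(4))
  moreover have "commutator YP6 YP5 \<doteq> (2 * \<i>) *\<^sub>o (K_op - id + (1 / 2) *\<^sub>o (YP5 \<cdot> YP5))"
    by (rule op_eqI; (simp add: abs A_N n_sum_sq A_B_eq)?) (simp add: algebra_simps)
  \<comment> \<open>\<open>[B, N] = - [A, N]\<close>, so passing from \<open>YP6\<close> to
    \<open>YP7 = B - A\<close> multiplies the right-hand side by -2.\<close>
  moreover have "commutator YP7 YP5 \<doteq> (- 4 * \<i>) *\<^sub>o (K_op - id + (1 / 2) *\<^sub>o (YP5 \<cdot> YP5))"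
    by (rule op_eqI; (simp add: abs commutator_diff A_N B_N n_sum_sq A_B_eq)?)
      (rule sop_eqI, simp add: eval_scal_linear algebra_simps)
  moreover have "commutator K_op (Y_op hbar) \<doteq> (2 * \<i>) *\<^sub>o Z_op hbar"
    by (rule op_eqI) (simp_all add: abs K_orbital)
  moreover have "commutator K_op (X_op hbar) \<doteq> (- 2 * \<i>) *\<^sub>o Z_op hbar"
    by (rule op_eqI) (simp_all add: abs K_orbital)
  moreover have "commutator K_op (Z_op hbar) \<doteq> (4 * \<i>) *\<^sub>o (X_op hbar - Y_op hbar)"
    by (rule op_eqI) (simp_all add: abs K_orbital)
  moreover have "commutator (Y_op hbar) (X_op hbar) \<doteq> (\<i> * hbar) *\<^sub>o Z_op hbar"
    by (rule op_eqI) (simp_all add: abs orbital_orbital(1))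
  moreover have "commutator (Y_op hbar) YP6 \<doteq> (2 * \<i>) *\<^sub>o YP3 hbar"
    by (rule op_eqI; (simp add: abs orbital_matrix_simp)?)
      (rule sop_eqI, simp add: eval_scal_linear algebra_simps)
  moreover have "commutator (X_op hbar) YP6 \<doteq> (- \<i> * hbar) *\<^sub>o YP5"
    by (rule op_eqI) (simp_all add: abs orbital_matrix(3))
  moreover have "commutator (Y_op hbar) YP7 \<doteq> (\<i> * hbar) *\<^sub>o YP5 - (2 * \<i>) *\<^sub>o YP3 hbar"
    by (rule op_eqI; (simp add: abs commutator_diff orbital_matrix_simp orbital_matrix(4))?)
      (rule sop_eqI, simp add: eval_scal_linear algebra_simps)
  moreover have "commutator (X_op hbar) YP7 \<doteq> (- 2 * \<i>) *\<^sub>o YP2 hbar + (\<i> * hbar) *\<^sub>o YP5"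
    by (rule op_eqI; (simp add: abs commutator_diff orbital_matrix_simp orbital_matrix(3))?)
      (rule sop_eqI, simp add: eval_scal_linear algebra_simps)
  moreover have "commutator (Y_op hbar) YP5 \<doteq>
       (2 * \<i>) *\<^sub>o YP1 hbar - (2 * \<i> * hbar) *\<^sub>o (YP6 + YP7)"
    by (rule op_eqI; (simp add: abs orbital_N)?)
      (rule sop_eqI, simp add: eval_scal_linear algebra_simps)
  \<comment> \<open>In \<open>YP1 + YP4\<close> the terms \<open>A X\<close> cancel, leaving
    \<open>- B Y - (i h / 2) N\<close>.\<close>
  moreover have "commutator (X_op hbar) YP5 \<doteq>
       (- 2 * \<i>) *\<^sub>o (YP1 hbar + YP4 hbar) + (2 * \<i> * hbar) *\<^sub>o YP6"
    by (rule op_eqI; (simp add: abs orbital_N)?)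
      (rule sop_eqI, simp add: eval_scal_linear algebra_simps)
  moreover have "commutator (Y_op hbar) (Z_op hbar) \<doteq>
       (2 * \<i>) *\<^sub>o (K_op \<cdot> L_sq hbar)
       - \<i> *\<^sub>o (Y_op hbar \<cdot> X_op hbar + X_op hbar \<cdot> Y_op hbar)
       - (2 * \<i> * hbar) *\<^sub>o X_op hbar"
    by (rule op_eqI) (simp_all add: abs orbital_orbital(2))
  moreover have "commutator (X_op hbar) (Z_op hbar) \<doteq>
       (- 2 * \<i>) *\<^sub>o (K_op \<cdot> L_sq hbar)
       + \<i> *\<^sub>o (Y_op hbar \<cdot> X_op hbar + X_op hbar \<cdot> Y_op hbar)
       + (2 * \<i> * hbar) *\<^sub>o Y_op hbar"
    by (rule op_eqI) (simp_all add: abs orbital_orbital(3))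
  moreover have "L_sq hbar \<doteq>
       J_sq hbar - hbar *\<^sub>o (X_op hbar + Y_op hbar) - (hbar\<^sup>2 / 4) *\<^sub>o (6 *\<^sub>o id + 2 *\<^sub>o K_op)"
    by (rule op_eqI) (simp_all add: abs J2_eq)
  moreover have "YP1 hbar \<doteq> - (YP6 \<cdot> X_op hbar) + (\<i> * hbar / 2) *\<^sub>o YP5"
    by (rule op_eqI) (simp_all add: abs)
  moreover have "YP2 hbar \<doteq> (- \<i>) *\<^sub>o ((YP6 + YP7) \<cdot> (X_op hbar + hbar *\<^sub>o id))"
    by (rule op_eqI) (simp_all add: abs)
  moreover have "YP3 hbar \<doteq> \<i> *\<^sub>o (YP6 \<cdot> (Y_op hbar + hbar *\<^sub>o id))"
    by (rule op_eqI) (simp_all add: abs)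
  moreover have "YP4 hbar \<doteq>
       YP6 \<cdot> X_op hbar - (YP6 + YP7) \<cdot> Y_op hbar - (\<i> * hbar) *\<^sub>o YP5"
    by (rule op_eqI) (simp_all add: abs)
  ultimately show ?thesis by (intro conjI)
qed

end
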